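(* Let $0<p<\infty$ and $\alpha>0$, and let $\mu$ be a positive Borel measure on $[0,1)$. Suppose that one of the following two cases holds: (i) $0<p\le 1$ and $\mu$ is a $1/p$-Carleson measure; (ii) $1<p<\infty$ and $\mu$ is a $1$-Carleson measure. Then for every $f(z)=\sum_{k=0}^\infty a_k z^k\in H^p$ the power series $$\mathcal{H}_{\mu,\alpha}(f)(z)=\sum_{n=0}^{\infty}\left(\sum_{k=0}^{\infty}\mu_{n,k,\alpha}\,a_k\right)z^n$$ is a well defined analytic function in $\mathbb{D}$. Furthermore, in such cases, for every $f\in H^p$, $$\mathcal{H}_{\mu,\alpha}(f)(z)=\int_{[0,1)}\frac{f(t)}{(1-tz)^{\alpha}}\,\mathrm{d}\mu(t),\qquad z\in\mathbb{D}.$$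
   Context: $\mathbb{D}=\{z\in\mathbb{C}:|z|<1\}$ and $H(\mathbb{D})$ is the class of analytic functions on $\mathbb{D}$. For $0<p<\infty$, the Hardy space $H^p$ is the set of $f\in H(\mathbb{D})$ with $\|f\|_{H^p}=\sup_{0<r<1}\left(\frac{1}{2\pi}\int_0^{2\pi}|f(re^{i\theta})|^p\,\mathrm{d}\theta\right)^{1/p}<\infty$. For $s>0$, a positive Borel measure $\mu$ on $[0,1)$ is an $s$-Carleson measure if there is a constant $C>0$ with $\mu([t,1))\le C(1-t)^s$ for all $0\le t<1$. For $\alpha>0$ and a positive Borel measure $\mu$ on $[0,1)$, the generalized Hankel matrix $(\mu_{n,k,\alpha})_{n,k\ge0}$ has entries $\mu_{n,k,\alpha}=\int_{[0,1)}\frac{\Gamma(n+\alpha)}{n!\,\Gamma(\alpha)}t^{n+k}\,\mathrm{d}\mu(t)$. "Well defined analytic function in $\mathbb{D}$" means that for each $n$ the inner series in $k$ converges and that the resulting power series in $z$ converges in $\mathbb{D}$. The power $(1-tz)^{\alpha}$ is taken with the principal branch. *)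

theory Defs
  imports "HOL-Analysis.Analysis"
begin

text \<open>The unit disc is \<^term>\<open>ball (0::complex) 1\<close>. A positive Borel measure on \<open>[0,1)\<close> is a
  measure whose space is \<open>[0,1)\<close> itself; it may be infinite, as no finiteness is imposed here.\<close>

definition borel_measure_01 :: "real measure \<Rightarrow> bool" where
  "borel_measure_01 \<mu> \<longleftrightarrow> sets \<mu> = sets (restrict_space borel {0..<1})"

definition carleson_measure :: "real \<Rightarrow> real measure \<Rightarrow> bool" where
  "carleson_measure s \<mu> \<longleftrightarrow>
     (\<exists>C>0. \<forall>t\<in>{0..<1}. emeasure \<mu> {t..<1} \<le> ennreal (C * (1 - t) powr s))"

definition hardy_mean :: "real \<Rightarrow> (complex \<Rightarrow> complex) \<Rightarrow> real \<Rightarrow> real" where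
  "hardy_mean p f r =
     (1 / (2 * pi) * integral {0..2 * pi} (\<lambda>\<theta>. norm (f (of_real r * cis \<theta>)) powr p)) powr (1 / p)"

definition hardy_norm :: "real \<Rightarrow> (complex \<Rightarrow> complex) \<Rightarrow> ennreal" where
  "hardy_norm p f = (SUP r\<in>{0<..<1}. ennreal (hardy_mean p f r))"

text \<open>Elements are total functions on \<open>\<complex>\<close>; only their values on the unit disc matter.\<close>

definition hardy_space :: "real \<Rightarrow> (complex \<Rightarrow> complex) set" where
  "hardy_space p = {f. f holomorphic_on ball 0 1 \<and> hardy_norm p f < \<infinity>}"

definition hankel_entry :: "real measure \<Rightarrow> real \<Rightarrow> nat \<Rightarrow> nat \<Rightarrow> real" where
  "hankel_entry \<mu> \<alpha> n k =
     (\<integral>t. Gamma (real n + \<alpha>) / (fact n * Gamma \<alpha>) * t ^ (n + k) \<partial>\<mu>)"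

text \<open>The operator acts on \<open>f\<close> through its sequence \<open>a\<close> of Taylor coefficients at \<open>0\<close>.\<close>

definition hankel_coeff :: "real measure \<Rightarrow> real \<Rightarrow> (nat \<Rightarrow> complex) \<Rightarrow> nat \<Rightarrow> complex" where
  "hankel_coeff \<mu> \<alpha> a n = (\<Sum>k. of_real (hankel_entry \<mu> \<alpha> n k) * a k)"

definition hankel_op :: "real measure \<Rightarrow> real \<Rightarrow> (nat \<Rightarrow> complex) \<Rightarrow> complex \<Rightarrow> complex" where
  "hankel_op \<mu> \<alpha> a z = (\<Sum>n. hankel_coeff \<mu> \<alpha> a n * z ^ n)"

end

theory Submission
  imports Defs "HOL-Complex_Analysis.Conformal_Mappings"
begin

text \<open>Write \<open>m k\<close> for the moment \<open>\<integral>t ^ k \<partial>\<mu>\<close>. The theorem follows by dominated interchange of sums and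
integrals from the single estimate \<open>\<Sum>k. |a k| m k < \<infinity>\<close> (\<open>hardy_coefficient_moments_summable\<close>): it
makes the inner series converge absolutely and \<open>f\<close> integrable along the radius, and the factors
\<open>\<gamma> n = Gamma (n + \<alpha>) / (n! Gamma \<alpha>)\<close> are the coefficients of \<open>(1 - w) powr (- \<alpha>)\<close>, which produces the
kernel of the integral representation.

For \<open>p > 1\<close> the estimate follows from the case \<open>p = 1\<close>, because \<open>H\<^sup>p\<close> is contained in \<open>H\<^sup>1\<close>. So let
\<open>p \<le> 1\<close>, and let \<open>A(r) = \<Sum>k. |a k| r ^ k\<close>. As \<open>A\<close> is increasing, the Carleson condition bounds its
integral by a multiple of \<open>\<Sum>j. (1 / 2 ^ j) powr (1 / p) * A (1 - 1 / 2 ^ j)\<close>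
(\<open>carleson_integral_le_dyadic\<close>), and it remains to bound this dyadic sum.

By Cauchy--Schwarz \<open>A(r)\<close> is at most \<open>(1 - r) powr (- 1 / 2)\<close> times the quadratic mean of \<open>f\<close> over the
circle of radius \<open>sqrt r\<close>. Moving the zeros of \<open>f\<close> out of the disc and taking a root gives a
holomorphic \<open>G\<close> with \<open>|f| \<le> |G| powr (2 / p)\<close> whose coefficients \<open>c i\<close> satisfy \<open>\<Sum>i. |c i|\<^sup>2 \<le> M\<close>,
where \<open>M\<close> bounds the means of \<open>|f| powr p\<close> (\<open>hardy_root_majorant\<close>). Since
\<open>|G|\<^sup>2 \<le> M / (1 - r)\<close> on that circle, only the mean of \<open>|G| ^ 4\<close> has to be understood. The coefficients of
\<open>G\<^sup>2\<close> are convolutions, and a weighted Cauchy--Schwarz inequality bounds that mean by \<open>4 T(r)\<^sup>2\<close>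
with \<open>T(r) = \<Sum>i. |c i|\<^sup>2 sqrt (i + 1) r ^ i\<close> (\<open>mean_fourth_power_le\<close>). Altogether the \<open>j\<close>-th
dyadic term is at most \<open>2 M powr (1 / p - 1) * sqrt (1 / 2 ^ j) * T (1 - 1 / 2 ^ j)\<close>. The sum over \<open>j\<close> is
finite because \<open>\<Sum>j. sqrt ((i + 1) / 2 ^ j) * (1 - 1 / 2 ^ j) ^ i\<close> is bounded uniformly in \<open>i\<close>
(\<open>dyadic_schur_sum_le\<close>).\<close>

section \<open>Means over circles\<close>

definition circle_mean :: "(complex \<Rightarrow> real) \<Rightarrow> real \<Rightarrow> real" where
  "circle_mean u r = 1 / (2 * pi) * integral {0..2 * pi} (\<lambda>\<theta>. u (of_real r * cis \<theta>))"

lemma continuous_on_circle: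
  fixes u :: "complex \<Rightarrow> 'a::topological_space"
  assumes "continuous_on S u" "sphere 0 r \<subseteq> S" "0 \<le> r"
  shows "continuous_on A (\<lambda>\<theta>. u (of_real r * cis \<theta>))"
proof (rule continuous_on_compose2[OF assms(1)])
  show "continuous_on A (\<lambda>\<theta>. of_real r * cis \<theta>)" by (intro continuous_intros)
  show "(\<lambda>\<theta>. complex_of_real r * cis \<theta>) ` A \<subseteq> S"
    using assms(2,3) by (auto simp: norm_mult)
qed

lemma circle_mean_mono:
  assumes "continuous_on S u" "continuous_on S v" "sphere 0 r \<subseteq> S" "0 \<le> r"
    and "\<And>z. norm z = r \<Longrightarrow> u z \<le> v z"
  shows "circle_mean u r \<le> circle_mean v r"
proof -
  have "integral {0..2 * pi} (\<lambda>\<theta>. u (of_real r * cis \<theta>))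
      \<le> integral {0..2 * pi} (\<lambda>\<theta>. v (of_real r * cis \<theta>))"
    using assms
    by (intro integral_le integrable_continuous_real continuous_on_circle[of S])
       (auto simp: norm_mult)
  then show ?thesis unfolding circle_mean_def by (intro mult_left_mono) auto
qed

lemma circle_mean_cmult: "circle_mean (\<lambda>z. c * u z) r = c * circle_mean u r"
  by (simp add: circle_mean_def)

lemma circle_mean_one [simp]: "circle_mean (\<lambda>z. 1) r = 1"
  by (simp add: circle_mean_def)

lemma circle_mean_add:
  assumes "continuous_on S u" "continuous_on S v" "sphere 0 r \<subseteq> S" "0 \<le> r"
  shows "circle_mean (\<lambda>z. u z + v z) r = circle_mean u r + circle_mean v r"
  unfolding circle_mean_def
  by (subst integral_add)
     (intro integrable_continuous_real continuous_on_circle[of S] assms,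
      intro integrable_continuous_real continuous_on_circle[of S] assms, simp add: field_simps)

lemma circle_mean_cong:
  assumes "\<And>z. norm z = r \<Longrightarrow> u z = v z" "0 \<le> r"
  shows "circle_mean u r = circle_mean v r"
  using assms by (simp add: circle_mean_def norm_mult)

lemma circle_mean_scale: "circle_mean (\<lambda>z. u (of_real R * z)) r = circle_mean u (R * r)"
  by (simp add: circle_mean_def mult.assoc)

lemma circle_mean_nonneg:
  assumes "\<And>z. norm z = r \<Longrightarrow> 0 \<le> u z" "0 \<le> r"
  shows "0 \<le> circle_mean u r"
proof -
  have "0 \<le> integral {0..2 * pi} (\<lambda>\<theta>. u (of_real r * cis \<theta>))"
  proof (cases "(\<lambda>\<theta>. u (of_real r * cis \<theta>)) integrable_on {0..2 * pi}")
    case True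
    then show ?thesis using assms by (intro integral_nonneg) (auto simp: norm_mult)
  next
    case False
    then show ?thesis by (simp add: not_integrable_integral)
  qed
  then show ?thesis by (simp add: circle_mean_def)
qed

lemma circle_mean_continuous_on:
  assumes "continuous_on (cball 0 R) u"
  shows "continuous_on {0..R} (circle_mean u)"
proof -
  have "continuous_on ({0..R} \<times> cbox 0 (2 * pi)) (\<lambda>(r, \<theta>). u (of_real r * cis \<theta>))"
    unfolding split_beta
    by (rule continuous_on_compose2[OF assms]) (auto intro!: continuous_intros simp: norm_mult)
  from integral_continuous_on_param[OF this]
  have "continuous_on {0..R} (\<lambda>r. integral {0..2 * pi} (\<lambda>\<theta>. u (of_real r * cis \<theta>)))"
    by simp
  then show ?thesis unfolding circle_mean_def by (intro continuous_intros)
qed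

section \<open>Parseval's identity for power series\<close>

lemma cis_orthogonal:
  "((\<lambda>\<theta>. cis (of_int m * \<theta>)) has_integral (if m = 0 then of_real (2 * pi) else 0)) {0..2 * pi}"
proof (cases "m = 0")
  case True
  then show ?thesis
    using has_integral_const_real[of "1::complex" 0 "2 * pi"] by (simp add: scaleR_conv_of_real)
next
  case False
  let ?F = "\<lambda>\<theta>. cis (of_int m * \<theta>) / (\<i> * of_int m)"
  have "((\<lambda>\<theta>. cis (of_int m * \<theta>)) has_integral ?F (2 * pi) - ?F 0) {0..2 * pi}"
  proof (rule fundamental_theorem_of_calculus)
    fix x :: real
    have "((\<lambda>z. exp (\<i> * (of_int m * z)) / (\<i> * of_int m)) has_field_derivative
        exp (\<i> * (of_int m * of_real x))) (at (of_real x))"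
      using False by (auto intro!: derivative_eq_intros simp: mult.commute mult.left_commute)
    then have "((\<lambda>t::real. exp (\<i> * (of_int m * of_real t)) / (\<i> * of_int m)) has_vector_derivative
        exp (\<i> * (of_int m * of_real x))) (at x within {0..2 * pi})"
      by (rule has_vector_derivative_real_field)
    then show "(?F has_vector_derivative cis (of_int m * x)) (at x within {0..2 * pi})"
      by (simp add: cis_conv_exp)
  qed simp
  moreover have "cis (of_int m * (2 * pi)) = 1"
    using cis_multiple_2pi[of "of_int m"] by (simp add: mult.commute mult.left_commute)
  ultimately show ?thesis using False by simp
qed

lemma trig_polynomial_l2:
  fixes e :: "nat \<Rightarrow> complex"
  shows "((\<lambda>\<theta>. (norm (\<Sum>k<N. e k * cis (real k * \<theta>)))\<^sup>2) has_integral
     (2 * pi * (\<Sum>k<N. (norm (e k))\<^sup>2))) {0..2 * pi}"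
proof -
  let ?S = "\<lambda>\<theta>. \<Sum>k<N. e k * cis (real k * \<theta>)"
  have sq: "of_real ((norm (?S \<theta>))\<^sup>2)
      = (\<Sum>k<N. \<Sum>l<N. e k * cnj (e l) * cis (of_int (int k - int l) * \<theta>))" for \<theta>
  proof -
    have "of_real ((norm (?S \<theta>))\<^sup>2) = ?S \<theta> * cnj (?S \<theta>)"
      using complex_norm_square by blast
    also have "\<dots> = (\<Sum>k<N. \<Sum>l<N. e k * cis (real k * \<theta>) * (cnj (e l) * cis (- (real l * \<theta>))))"
      by (simp add: sum_product cis_cnj)
    also have "\<dots> = (\<Sum>k<N. \<Sum>l<N. e k * cnj (e l) * cis (of_int (int k - int l) * \<theta>))"
    proof (intro sum.cong refl)
      fix k l
      have "cis (of_int (int k - int l) * \<theta>) = cis (real k * \<theta>) * cis (- (real l * \<theta>))"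
        by (simp add: cis_mult algebra_simps)
      then show "e k * cis (real k * \<theta>) * (cnj (e l) * cis (- (real l * \<theta>)))
          = e k * cnj (e l) * cis (of_int (int k - int l) * \<theta>)"
        by simp
    qed
    finally show ?thesis .
  qed
  have "((\<lambda>\<theta>. \<Sum>k<N. \<Sum>l<N. e k * cnj (e l) * cis (of_int (int k - int l) * \<theta>)) has_integral
      (\<Sum>k<N. \<Sum>l<N. e k * cnj (e l) * (if int k - int l = 0 then of_real (2 * pi) else 0)))
      {0..2 * pi}"
    by (intro has_integral_sum has_integral_mult_right cis_orthogonal) auto
  also have "(\<Sum>k<N. \<Sum>l<N. e k * cnj (e l) * (if int k - int l = 0 then of_real (2 * pi) else 0))
      = (\<Sum>k<N. e k * cnj (e k) * of_real (2 * pi))"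
  proof (intro sum.cong refl)
    fix k assume "k \<in> {..<N}"
    have "(\<Sum>l<N. e k * cnj (e l) * (if int k - int l = 0 then of_real (2 * pi) else 0))
        = (\<Sum>l<N. if k = l then e k * cnj (e k) * of_real (2 * pi) else 0)"
      by (intro sum.cong refl) auto
    with \<open>k \<in> {..<N}\<close> show "(\<Sum>l<N. e k * cnj (e l) * (if int k - int l = 0 then of_real (2 * pi) else 0))
        = e k * cnj (e k) * of_real (2 * pi)"
      by simp
  qed
  also have "\<dots> = (\<Sum>k<N. of_real ((norm (e k))\<^sup>2) * of_real (2 * pi))"
    by (simp only: complex_norm_square)
  also have "\<dots> = of_real (2 * pi * (\<Sum>k<N. (norm (e k))\<^sup>2))"
    by (simp add: sum_distrib_left mult_ac)
  finally have "((\<lambda>\<theta>. complex_of_real ((norm (?S \<theta>))\<^sup>2)) has_integral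
      of_real (2 * pi * (\<Sum>k<N. (norm (e k))\<^sup>2))) {0..2 * pi}"
    by (simp only: sq)
  from has_integral_linear[OF this bounded_linear_Re] show ?thesis
    by (simp only: o_def Re_complex_of_real)
qed

lemma power_series_abs_summable:
  fixes c :: "nat \<Rightarrow> complex"
  assumes "\<And>z. z \<in> ball 0 1 \<Longrightarrow> summable (\<lambda>k. c k * z ^ k)" "0 \<le> r" "r < 1"
  shows "summable (\<lambda>k. norm (c k) * r ^ k)"
proof -
  obtain s where s: "r < s" "s < 1" using dense assms(3) by blast
  have "summable (\<lambda>k. c k * (of_real s) ^ k)" using assms s by auto
  then have "summable (\<lambda>k. norm (c k * (of_real r) ^ k))"
    by (rule powser_insidea) (use s assms in auto)
  then show ?thesis using assms by (simp add: norm_mult norm_power)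
qed

lemma parseval_power_series:
  fixes h :: "complex \<Rightarrow> complex" and c :: "nat \<Rightarrow> complex"
  assumes h: "\<And>z. z \<in> ball 0 1 \<Longrightarrow> (\<lambda>k. c k * z ^ k) sums h z"
    and r: "0 \<le> r" "r < 1"
  shows "(\<lambda>k. (norm (c k))\<^sup>2 * (r\<^sup>2) ^ k) sums circle_mean (\<lambda>z. (norm (h z))\<^sup>2) r"
proof -
  have abs_sum: "summable (\<lambda>k. norm (c k) * r ^ k)"
    by (rule power_series_abs_summable) (use h r in \<open>auto simp: sums_iff\<close>)
  define B where "B = (\<Sum>k. norm (c k) * r ^ k)"
  define s where "s = (\<lambda>N \<theta>. \<Sum>k<N. c k * of_real r ^ k * cis (real k * \<theta>))"
  have s_int: "((\<lambda>\<theta>. (norm (s N \<theta>))\<^sup>2) has_integral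
      (2 * pi * (\<Sum>k<N. (norm (c k * of_real r ^ k))\<^sup>2))) {0..2 * pi}" for N
    unfolding s_def by (rule trig_polynomial_l2)
  have s_le: "norm (s N \<theta>) \<le> B" for N \<theta>
  proof -
    have "norm (s N \<theta>) \<le> (\<Sum>k<N. norm (c k) * r ^ k)"
      unfolding s_def using r
      by (intro sum_norm_le) (simp add: norm_mult norm_power)
    also have "\<dots> \<le> B" unfolding B_def
      by (rule sum_le_suminf) (use abs_sum r in auto)
    finally show ?thesis .
  qed
  have lim: "(\<lambda>N. s N \<theta>) \<longlonglongrightarrow> h (of_real r * cis \<theta>)" for \<theta>
  proof -
    have "(\<lambda>k. c k * (of_real r * cis \<theta>) ^ k) sums h (of_real r * cis \<theta>)"
      by (rule h) (use r in \<open>simp add: norm_mult\<close>)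
    then show ?thesis
      unfolding sums_def s_def by (simp add: power_mult_distrib Complex.DeMoivre mult.assoc)
  qed
  have "(\<lambda>N. integral {0..2 * pi} (\<lambda>\<theta>. (norm (s N \<theta>))\<^sup>2)) \<longlonglongrightarrow>
      integral {0..2 * pi} (\<lambda>\<theta>. (norm (h (of_real r * cis \<theta>)))\<^sup>2)"
  proof (rule dominated_convergence(2))
    show "(\<lambda>\<theta>. (norm (s N \<theta>))\<^sup>2) integrable_on {0..2 * pi}" for N
      using s_int by blast
    show "(\<lambda>\<theta>. B\<^sup>2) integrable_on {0..2 * pi}" by (rule integrable_const_ivl)
    show "norm ((norm (s N \<theta>))\<^sup>2) \<le> B\<^sup>2" for N \<theta>
      using s_le[of N \<theta>] by (simp add: power_mono)
    show "(\<lambda>N. (norm (s N \<theta>))\<^sup>2) \<longlonglongrightarrow> (norm (h (of_real r * cis \<theta>)))\<^sup>2" for \<theta>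
      by (intro tendsto_intros lim)
  qed
  moreover have "integral {0..2 * pi} (\<lambda>\<theta>. (norm (s N \<theta>))\<^sup>2)
      = 2 * pi * (\<Sum>k<N. (norm (c k * of_real r ^ k))\<^sup>2)" for N
    using s_int by blast
  ultimately have "(\<lambda>N. 1 / (2 * pi) * (2 * pi * (\<Sum>k<N. (norm (c k * of_real r ^ k))\<^sup>2)))
      \<longlonglongrightarrow> circle_mean (\<lambda>z. (norm (h z))\<^sup>2) r"
    unfolding circle_mean_def by (intro tendsto_intros) simp
  moreover have "(norm (c k * of_real r ^ k))\<^sup>2 = (norm (c k))\<^sup>2 * (r\<^sup>2) ^ k" for k
    using r by (simp add: norm_mult norm_power power_mult_distrib power_mult [symmetric] mult.commute)
  ultimately show ?thesis by (simp add: sums_def)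
qed

lemma bessel_power_series:
  fixes h :: "complex \<Rightarrow> complex" and c :: "nat \<Rightarrow> complex"
  assumes h: "\<And>z. z \<in> ball 0 1 \<Longrightarrow> (\<lambda>k. c k * z ^ k) sums h z"
    and r: "0 \<le> r" "r < 1"
  shows "(\<Sum>k<N. (norm (c k))\<^sup>2 * (r\<^sup>2) ^ k) \<le> circle_mean (\<lambda>z. (norm (h z))\<^sup>2) r"
proof -
  have "(\<Sum>k<N. (norm (c k))\<^sup>2 * (r\<^sup>2) ^ k) \<le> (\<Sum>k. (norm (c k))\<^sup>2 * (r\<^sup>2) ^ k)"
    by (rule sum_le_suminf) (use sums_summable[OF parseval_power_series[OF assms]] in auto)
  also have "\<dots> = circle_mean (\<lambda>z. (norm (h z))\<^sup>2) r"
    by (rule sums_unique[symmetric, OF parseval_power_series[OF assms]])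
  finally show ?thesis .
qed

section \<open>Removing the zeros of a function\<close>

text \<open>For \<open>|a| < 1\<close> the quotient \<open>(z - a) / (1 - cnj a * z)\<close> is a Blaschke factor: it maps the disc to
itself and the circle to itself, because
\<open>|1 - cnj a z|\<^sup>2 - |z - a|\<^sup>2 = (1 - |a|\<^sup>2) (1 - |z|\<^sup>2)\<close>.\<close>

lemma norm_diff_le_norm_one_minus_cnj_mult:
  assumes "norm a < 1" "norm z \<le> 1"
  shows "norm (z - a) \<le> norm (1 - cnj a * z)"
    and "norm z = 1 \<Longrightarrow> norm (z - a) = norm (1 - cnj a * z)"
proof -
  have id: "(norm (1 - cnj a * z))\<^sup>2 - (norm (z - a))\<^sup>2 = (1 - (norm a)\<^sup>2) * (1 - (norm z)\<^sup>2)"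
    unfolding cmod_power2 by (simp add: power2_eq_square algebra_simps)
  have "0 \<le> (1 - (norm a)\<^sup>2) * (1 - (norm z)\<^sup>2)"
    using assms by (intro mult_nonneg_nonneg) (auto simp: power_le_one)
  with id have "(norm (z - a))\<^sup>2 \<le> (norm (1 - cnj a * z))\<^sup>2" by linarith
  then show "norm (z - a) \<le> norm (1 - cnj a * z)" by (rule power2_le_imp_le) simp
  assume "norm z = 1"
  with id have "(norm (z - a))\<^sup>2 = (norm (1 - cnj a * z))\<^sup>2" by simp
  then show "norm (z - a) = norm (1 - cnj a * z)" by simp
qed

text \<open>Each zero \<open>a\<close> in the disc, of order \<open>n\<close>, is moved outside by trading the factor \<open>(z - a) ^ n\<close> for
\<open>(1 - cnj a z) ^ n\<close>. The Blaschke inequality says that this does not decrease the modulus inside the disc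
and preserves it on the circle. The induction is on the number of distinct zeros.\<close>

lemma zero_free_majorant:
  assumes "1 < \<rho>" "f holomorphic_on ball 0 \<rho>" "finite {z \<in> ball 0 1. f z = 0}"
  shows "\<exists>g. g holomorphic_on ball 0 \<rho> \<and> (\<forall>z\<in>ball 0 1. g z \<noteq> 0) \<and>
    (\<forall>z\<in>ball 0 1. norm (f z) \<le> norm (g z)) \<and> (\<forall>z\<in>sphere 0 1. norm (g z) = norm (f z))"
  using assms(2,3)
proof (induction "card {z \<in> ball 0 1. f z = 0}" arbitrary: f rule: less_induct)
  case less
  let ?Z = "\<lambda>f. {z \<in> ball 0 1. f z = (0::complex)}"
  show ?case
  proof (cases "?Z f = {}")
    case True
    then show ?thesis using less.prems by (intro exI[of _ f]) auto
  next
    case False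
    then obtain a where a: "norm a < 1" "f a = 0" by auto
    have nonconst: "\<not> f constant_on ball 0 \<rho>"
    proof
      assume "f constant_on ball 0 \<rho>"
      then have "\<forall>z\<in>ball 0 \<rho>. f z = 0"
        unfolding constant_on_def using a assms(1) by (metis dist_0_norm less_trans mem_ball)
      then have "?Z f = ball 0 1" using assms(1) by auto
      then show False
        using less.prems(2) finite_imp_not_open[of "ball (0::complex) 1"] by (metis centre_in_ball empty_iff open_ball zero_less_one)
    qed
    obtain q r n where n: "0 < n" and r: "0 < r" "ball a r \<subseteq> ball 0 \<rho>"
      and q: "q holomorphic_on ball a r" "\<And>w. w \<in> ball a r \<Longrightarrow> f w = (w - a) ^ n * q w"
        "\<And>w. w \<in> ball a r \<Longrightarrow> q w \<noteq> 0"
    proof (rule holomorphic_factor_zero_nonconstant[OF less.prems(1) open_ball connected_ball _ a(2) nonconst])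
      show "a \<in> ball 0 \<rho>" using a(1) assms(1) by simp
    qed blast
    \<comment> \<open>The local quotient by \<open>(w - a) ^ n\<close>, extended to the whole disc.\<close>
    define Q where "Q = (\<lambda>w. if w \<in> ball a r then q w else f w / (w - a) ^ n)"
    have Qeq: "Q w = f w / (w - a) ^ n" if "w \<noteq> a" for w
      using that q(2)[of w] by (simp add: Q_def)
    have Qf: "f w = (w - a) ^ n * Q w" for w
      by (cases "w = a") (use n a in \<open>auto simp: Qeq\<close>)
    have Qa: "Q a \<noteq> 0" using q(3)[of a] r by (simp add: Q_def)
    have "Q holomorphic_on ball a r" using q(1) by (rule holomorphic_transform) (simp add: Q_def)
    moreover have "Q holomorphic_on (ball 0 \<rho> - {a})"
    proof (rule holomorphic_transform)
      show "(\<lambda>w. f w / (w - a) ^ n) holomorphic_on (ball 0 \<rho> - {a})"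
        by (intro holomorphic_intros holomorphic_on_subset[OF less.prems(1)]) auto
    qed (simp add: Qeq)
    ultimately have "Q holomorphic_on (ball a r \<union> (ball 0 \<rho> - {a}))"
      by (rule holomorphic_on_Un) auto
    then have Qhol: "Q holomorphic_on ball 0 \<rho>"
      by (rule holomorphic_on_subset) (use r in auto)
    define F where "F = (\<lambda>w. (1 - cnj a * w) ^ n * Q w)"
    have nz: "1 - cnj a * w \<noteq> 0" if "norm w < 1" for w
    proof
      assume "1 - cnj a * w = 0"
      then have "norm a * norm w = 1" by (metis complex_mod_cnj eq_iff_diff_eq_0 norm_mult norm_one)
      moreover have "norm a * norm w < 1 * 1" using a that by (intro mult_strict_mono') auto
      ultimately show False by simp
    qed
    have Fhol: "F holomorphic_on ball 0 \<rho>" unfolding F_def by (intro holomorphic_intros Qhol)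
    have "?Z F \<subseteq> ?Z f" using Qf nz by (auto simp: F_def)
    moreover have "a \<in> ?Z f" "a \<notin> ?Z F" using a Qa nz[of a] by (auto simp: F_def)
    ultimately have ZF: "?Z F \<subset> ?Z f" by blast
    obtain g where g: "g holomorphic_on ball 0 \<rho>" "\<forall>z\<in>ball 0 1. g z \<noteq> 0"
        "\<forall>z\<in>ball 0 1. norm (F z) \<le> norm (g z)" "\<forall>z\<in>sphere 0 1. norm (g z) = norm (F z)"
      using less.hyps[OF psubset_card_mono[OF less.prems(2) ZF] Fhol
          finite_subset[OF psubset_imp_subset[OF ZF] less.prems(2)]] by blast
    have "norm (f z) \<le> norm (F z)" if "norm z < 1" for z
      using norm_diff_le_norm_one_minus_cnj_mult(1)[of a z] a that
      by (simp add: Qf F_def norm_mult norm_power mult_right_mono power_mono)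
    moreover have "norm (f z) = norm (F z)" if "norm z = 1" for z
      using norm_diff_le_norm_one_minus_cnj_mult(2)[of a z] a that
      by (simp add: Qf F_def norm_mult norm_power)
    ultimately have "\<forall>z\<in>ball 0 1. norm (f z) \<le> norm (g z)" "\<forall>z\<in>sphere 0 1. norm (g z) = norm (f z)"
      using g(3,4) by (fastforce, simp)
    then show ?thesis using g(1,2) by blast
  qed
qed

text \<open>The coefficients of Parseval's series do not depend on the radius.\<close>

lemma circle_mean_square_mono:
  assumes "h holomorphic_on ball 0 1" "0 \<le> r" "r \<le> s" "s < 1"
  shows "circle_mean (\<lambda>z. (norm (h z))\<^sup>2) r \<le> circle_mean (\<lambda>z. (norm (h z))\<^sup>2) s"
proof -
  define c where "c = (\<lambda>n. (deriv ^^ n) h 0 / fact n)"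
  have "(\<lambda>k. c k * z ^ k) sums h z" if "z \<in> ball 0 1" for z
    using holomorphic_power_series[OF assms(1) that] by (simp add: c_def)
  note parseval = parseval_power_series[OF this]
  show ?thesis
    by (rule sums_le[OF _ parseval parseval])
       (use assms in \<open>auto intro!: mult_left_mono power_mono\<close>)
qed

text \<open>A substitute for the Riesz factorisation that avoids infinite Blaschke products and boundary values:
since \<open>f\<close> is holomorphic beyond the closed disc, it has finitely many zeros to remove. The
resulting \<open>g\<close> has a logarithm, so \<open>G = g powr (p / 2)\<close> is holomorphic. The mean of \<open>|G|\<^sup>2\<close>, which is
that of \<open>|g| powr p\<close>, increases with the radius and tends to the mean of \<open>|f| powr p\<close> over the unit
circle, where \<open>|g| = |f|\<close>. This turns a question about \<open>H\<^sup>p\<close> into one about square summable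
coefficients.\<close>

lemma hardy_root_majorant:
  assumes \<rho>: "1 < \<rho>" and hol: "f holomorphic_on ball 0 \<rho>" and p: "0 < p"
  obtains G where "G holomorphic_on ball 0 1"
    "\<And>z. z \<in> ball 0 1 \<Longrightarrow> norm (f z) \<le> norm (G z) powr (2 / p)"
    "\<And>r. 0 \<le> r \<Longrightarrow> r < 1 \<Longrightarrow>
       circle_mean (\<lambda>z. (norm (G z))\<^sup>2) r \<le> circle_mean (\<lambda>z. norm (f z) powr p) 1"
proof (cases "\<forall>z\<in>ball 0 1. f z = 0")
  case True
  show ?thesis
  proof (rule that[of "\<lambda>_. 0"])
    have "0 \<le> circle_mean (\<lambda>z. norm (f z) powr p) 1" by (rule circle_mean_nonneg) auto
    then show "circle_mean (\<lambda>z. (norm (0::complex))\<^sup>2) r \<le> circle_mean (\<lambda>z. norm (f z) powr p) 1" for r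
      by (simp add: circle_mean_def)
  qed (use True in auto)
next
  case False
  have sub: "ball (0::complex) 1 \<subseteq> ball 0 \<rho>" "cball (0::complex) 1 \<subseteq> ball 0 \<rho>" using \<rho> by auto
  have "finite {z \<in> ball 0 1. f z = 0}"
  proof (cases "f constant_on ball 0 \<rho>")
    case True
    then obtain y where "\<And>z. z \<in> ball 0 \<rho> \<Longrightarrow> f z = y" unfolding constant_on_def by blast
    then have y: "\<And>z. z \<in> ball 0 1 \<Longrightarrow> f z = y" using sub(1) by blast
    with False have "y \<noteq> 0" by metis
    with y have "{z \<in> ball 0 1. f z = 0} = {}" by auto
    then show ?thesis by (metis finite.emptyI)
  next
    case nonconst: False
    have "finite {z \<in> cball 0 1. f z = 0}"
      by (rule holomorphic_compact_finite_zeros[OF hol]) (use sub nonconst in auto)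
    then show ?thesis by (rule rev_finite_subset) auto
  qed
  from zero_free_majorant[OF \<rho> hol this] obtain g where
    g: "g holomorphic_on ball 0 \<rho>" "\<And>z. z \<in> ball 0 1 \<Longrightarrow> g z \<noteq> 0"
    "\<And>z. z \<in> ball 0 1 \<Longrightarrow> norm (f z) \<le> norm (g z)" "\<And>z. z \<in> sphere 0 1 \<Longrightarrow> norm (g z) = norm (f z)"
    by blast
  obtain L where L: "L holomorphic_on ball 0 1" "\<And>z. z \<in> ball 0 1 \<Longrightarrow> exp (L z) = g z"
    using holomorphic_logarithm_exists[of "ball 0 1" g 0] g(1,2) sub(1) holomorphic_on_subset by auto
  define G where "G = (\<lambda>z. exp (of_real (p / 2) * L z))"
  have Ghol: "G holomorphic_on ball 0 1" unfolding G_def by (intro holomorphic_intros L(1))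
  have Gg: "norm (G z) = norm (g z) powr (p / 2)" if "z \<in> ball 0 1" for z
  proof -
    have "norm (g z) = exp (Re (L z))" using L(2)[OF that] by (metis norm_exp_eq_Re)
    then show ?thesis by (simp add: G_def powr_def norm_exp_eq_Re)
  qed
  have gcont: "continuous_on (cball 0 1) (\<lambda>z. norm (g z) powr p)"
    using holomorphic_on_imp_continuous_on[OF g(1)] sub(2) p
    by (intro continuous_on_powr' continuous_intros) (auto intro: continuous_on_subset)
  have Gsq: "circle_mean (\<lambda>z. (norm (G z))\<^sup>2) r = circle_mean (\<lambda>z. norm (g z) powr p) r"
    if "0 \<le> r" "r < 1" for r
    by (rule circle_mean_cong) (use that in \<open>auto simp: Gg power2_eq_square powr_add [symmetric]\<close>)
  show ?thesis
  proof (rule that[OF Ghol])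
    fix z :: complex assume z: "z \<in> ball 0 1"
    then show "norm (f z) \<le> norm (G z) powr (2 / p)"
      using g(3)[OF z] p by (simp add: Gg powr_powr)
  next
    fix r :: real assume r: "0 \<le> r" "r < 1"
    have "(circle_mean (\<lambda>z. norm (g z) powr p) \<longlongrightarrow> circle_mean (\<lambda>z. norm (g z) powr p) 1) (at 1 within {0..1})"
      using circle_mean_continuous_on[OF gcont] by (auto simp: continuous_on_def)
    then have "(circle_mean (\<lambda>z. norm (g z) powr p) \<longlongrightarrow> circle_mean (\<lambda>z. norm (g z) powr p) 1) (at_left 1)"
      by (simp add: at_within_Icc_at_left)
    moreover have "eventually (\<lambda>s. circle_mean (\<lambda>z. (norm (G z))\<^sup>2) r
        \<le> circle_mean (\<lambda>z. norm (g z) powr p) s) (at_left 1)"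
      using eventually_at_left_real[OF r(2)]
    proof eventually_elim
      case (elim s)
      then show ?case
        using circle_mean_square_mono[OF Ghol r(1), of s] Gsq[of s] r by auto
    qed
    ultimately have "circle_mean (\<lambda>z. (norm (G z))\<^sup>2) r \<le> circle_mean (\<lambda>z. norm (g z) powr p) 1"
      by (rule tendsto_lowerbound) simp
    also have "\<dots> = circle_mean (\<lambda>z. norm (f z) powr p) 1"
      by (rule circle_mean_cong) (auto simp: g(4))
    finally show "circle_mean (\<lambda>z. (norm (G z))\<^sup>2) r \<le> circle_mean (\<lambda>z. norm (f z) powr p) 1" .
  qed
qed

section \<open>The fourth power mean of a square summable power series\<close>

lemma sum_inverse_sqrt_le: "(\<Sum>i<n. 1 / sqrt (real i + 1)) \<le> 2 * sqrt (real n)"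
proof (induction n)
  case (Suc n)
  have "1 / sqrt (real n + 1) \<le> 2 * (sqrt (real n + 1) - sqrt (real n))"
  proof -
    have "(sqrt (real n + 1) - sqrt (real n)) * (sqrt (real n + 1) + sqrt (real n)) = 1"
      by (simp add: algebra_simps)
    then have "1 = (sqrt (real n + 1) - sqrt (real n)) * (sqrt (real n + 1) + sqrt (real n))" ..
    also have "\<dots> \<le> (sqrt (real n + 1) - sqrt (real n)) * (2 * sqrt (real n + 1))"
      by (intro mult_left_mono) auto
    finally show ?thesis by (simp add: field_simps)
  qed
  with Suc show ?case by (simp add: add.commute)
qed simp

text \<open>A discrete beta integral. The bound is uniform in \<open>n\<close> because \<open>1 / sqrt (x y)\<close> is at most
\<open>(1 / sqrt x + 1 / sqrt y) / sqrt (x + y)\<close>, and \<open>x + y = n + 2\<close> is constant along the sum.\<close>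

lemma hilbert_kernel_sum_le:
  "(\<Sum>i\<le>n. 1 / (sqrt (real i + 1) * sqrt (real (n - i) + 1))) \<le> 4"
proof -
  have bound: "1 / (sqrt (real i + 1) * sqrt (real (n - i) + 1))
      \<le> (1 / sqrt (real n + 2)) * (1 / sqrt (real i + 1) + 1 / sqrt (real (n - i) + 1))"
    if "i \<le> n" for i
  proof -
    define x y where "x = real i + 1" and "y = real (n - i) + 1"
    have pos: "0 < x" "0 < y" by (auto simp: x_def y_def)
    have xy: "x + y = real n + 2" using that by (simp add: x_def y_def of_nat_diff)
    have "sqrt (x + y) \<le> sqrt x + sqrt y" using pos by (intro sqrt_add_le_add_sqrt) auto
    then have "1 / (sqrt x * sqrt y) \<le> (1 / sqrt (x + y)) * ((sqrt x + sqrt y) / (sqrt x * sqrt y))"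
      using pos by (simp add: field_simps)
    also have "(sqrt x + sqrt y) / (sqrt x * sqrt y) = 1 / sqrt x + 1 / sqrt y"
      using pos by (simp add: field_simps)
    finally show ?thesis by (simp add: xy) (simp add: x_def y_def)
  qed
  have "(\<Sum>i\<le>n. 1 / (sqrt (real i + 1) * sqrt (real (n - i) + 1)))
      \<le> (\<Sum>i\<le>n. (1 / sqrt (real n + 2)) * (1 / sqrt (real i + 1) + 1 / sqrt (real (n - i) + 1)))"
    by (intro sum_mono bound) auto
  also have "\<dots> = (1 / sqrt (real n + 2)) *
      ((\<Sum>i\<le>n. 1 / sqrt (real i + 1)) + (\<Sum>i\<le>n. 1 / sqrt (real (n - i) + 1)))"
    by (simp only: sum_distrib_left [symmetric] sum.distrib)
  also have "(\<Sum>i\<le>n. 1 / sqrt (real (n - i) + 1)) = (\<Sum>i\<le>n. 1 / sqrt (real i + 1))"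
    by (rule sum.reindex_bij_witness[of _ "\<lambda>i. n - i" "\<lambda>i. n - i"]) auto
  also have "(1 / sqrt (real n + 2)) * ((\<Sum>i\<le>n. 1 / sqrt (real i + 1)) + (\<Sum>i\<le>n. 1 / sqrt (real i + 1)))
      \<le> (1 / sqrt (real n + 2)) * (4 * sqrt (real n + 2))"
  proof (rule mult_left_mono)
    have "(\<Sum>i\<le>n. 1 / sqrt (real i + 1)) \<le> 2 * sqrt (real (Suc n))"
      using sum_inverse_sqrt_le[of "Suc n"] by (simp add: lessThan_Suc_atMost)
    also have "\<dots> \<le> 2 * sqrt (real n + 2)" by simp
    finally show "(\<Sum>i\<le>n. 1 / sqrt (real i + 1)) + (\<Sum>i\<le>n. 1 / sqrt (real i + 1)) \<le> 4 * sqrt (real n + 2)"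
      by simp
  qed simp
  also have "\<dots> = 4" by simp
  finally show ?thesis .
qed

text \<open>Cauchy--Schwarz with the weight \<open>((i + 1) (n - i + 1)) powr (1 / 4)\<close>. The exponent \<open>1 / 4\<close> is
the one for which the dual sum is bounded independently of \<open>n\<close>, so that the right-hand side is
again a convolution square, without any weight in \<open>n\<close>.\<close>

lemma convolution_square_le:
  fixes b :: "nat \<Rightarrow> real"
  shows "(\<Sum>i\<le>n. b i * b (n - i))\<^sup>2
    \<le> 4 * (\<Sum>i\<le>n. ((b i)\<^sup>2 * sqrt (real i + 1)) * ((b (n - i))\<^sup>2 * sqrt (real (n - i) + 1)))"
proof -
  define w where "w = (\<lambda>i. sqrt (sqrt (real i + 1) * sqrt (real (n - i) + 1)))"
  have w: "0 < w i" "(w i)\<^sup>2 = sqrt (real i + 1) * sqrt (real (n - i) + 1)" for i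
    by (auto simp: w_def)
  have "(\<Sum>i\<le>n. b i * b (n - i)) = (\<Sum>i\<le>n. (1 / w i) * (b i * b (n - i) * w i))"
    using w(1) by (intro sum.cong refl) (simp add: less_imp_neq [symmetric])
  then have "(\<Sum>i\<le>n. b i * b (n - i))\<^sup>2
      \<le> (\<Sum>i\<le>n. (1 / w i)\<^sup>2) * (\<Sum>i\<le>n. (b i * b (n - i) * w i)\<^sup>2)"
    using Cauchy_Schwarz_ineq_sum[of "\<lambda>i. 1 / w i" "\<lambda>i. b i * b (n - i) * w i" "{..n}"] by simp
  also have "\<dots> \<le> 4 * (\<Sum>i\<le>n. (b i * b (n - i) * w i)\<^sup>2)"
    using hilbert_kernel_sum_le[of n]
    by (intro mult_right_mono sum_nonneg) (auto simp: power_divide w(2))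
  also have "(\<Sum>i\<le>n. (b i * b (n - i) * w i)\<^sup>2)
      = (\<Sum>i\<le>n. ((b i)\<^sup>2 * sqrt (real i + 1)) * ((b (n - i))\<^sup>2 * sqrt (real (n - i) + 1)))"
    by (intro sum.cong refl) (simp add: power_mult_distrib w(2))
  finally show ?thesis .
qed

text \<open>Parseval's identity for \<open>G\<^sup>2\<close>, whose coefficients are the self-convolution of those of \<open>G\<close>. The radius
is \<open>sqrt r\<close> so that plain powers of \<open>r\<close> occur in the sums.\<close>

lemma mean_fourth_power_le:
  fixes G :: "complex \<Rightarrow> complex" and c :: "nat \<Rightarrow> complex"
  assumes G: "\<And>z. z \<in> ball 0 1 \<Longrightarrow> (\<lambda>k. c k * z ^ k) sums G z"
    and r: "0 \<le> r" "r < 1"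
    and T: "(\<lambda>i. (norm (c i))\<^sup>2 * sqrt (real i + 1) * r ^ i) sums T"
  shows "circle_mean (\<lambda>z. (norm (G z)) ^ 4) (sqrt r) \<le> 4 * T\<^sup>2"
proof -
  define d where "d = (\<lambda>n. \<Sum>i\<le>n. c i * c (n - i))"
  define u where "u = (\<lambda>i. (norm (c i))\<^sup>2 * sqrt (real i + 1) * r ^ i)"
  have u0: "0 \<le> u i" for i using r by (simp add: u_def)
  have d: "(\<lambda>n. d n * z ^ n) sums (G z)\<^sup>2" if z: "z \<in> ball 0 1" for z
  proof -
    have "summable (\<lambda>k. norm (c k) * norm z ^ k)"
      by (rule power_series_abs_summable) (use G z in \<open>auto simp: sums_iff\<close>)
    then have abs_sum: "summable (\<lambda>k. norm (c k * z ^ k))" by (simp add: norm_mult norm_power)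
    have "(\<lambda>n. \<Sum>i\<le>n. (c i * z ^ i) * (c (n - i) * z ^ (n - i))) sums
        ((\<Sum>k. c k * z ^ k) * (\<Sum>k. c k * z ^ k))"
      by (rule Cauchy_product_sums[OF abs_sum abs_sum])
    also have "(\<lambda>n. \<Sum>i\<le>n. (c i * z ^ i) * (c (n - i) * z ^ (n - i))) = (\<lambda>n. d n * z ^ n)"
    proof (rule ext)
      fix n
      have "(c i * z ^ i) * (c (n - i) * z ^ (n - i)) = c i * c (n - i) * z ^ n" if "i \<le> n" for i
      proof -
        have "z ^ n = z ^ i * z ^ (n - i)" using that by (simp flip: power_add)
        then show ?thesis by simp
      qed
      then show "(\<Sum>i\<le>n. (c i * z ^ i) * (c (n - i) * z ^ (n - i))) = d n * z ^ n"
        unfolding d_def sum_distrib_right by (intro sum.cong) blast+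
    qed
    also have "(\<Sum>k. c k * z ^ k) = G z" using G[OF z] by (simp add: sums_iff)
    finally show ?thesis by (simp add: power2_eq_square)
  qed
  have "(\<lambda>k. (norm (d k))\<^sup>2 * ((sqrt r)\<^sup>2) ^ k) sums circle_mean (\<lambda>z. (norm ((G z)\<^sup>2))\<^sup>2) (sqrt r)"
    by (rule parseval_power_series[OF d]) (use r in auto)
  then have parseval: "(\<lambda>k. (norm (d k))\<^sup>2 * r ^ k) sums circle_mean (\<lambda>z. (norm (G z)) ^ 4) (sqrt r)"
    using r by (simp add: norm_power power_mult [symmetric])
  have term_le: "(norm (d n))\<^sup>2 * r ^ n \<le> 4 * (\<Sum>i\<le>n. u i * u (n - i))" for n
  proof -
    have "norm (d n) \<le> (\<Sum>i\<le>n. norm (c i) * norm (c (n - i)))"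
      unfolding d_def by (rule sum_norm_le) (simp add: norm_mult)
    then have "(norm (d n))\<^sup>2 \<le> (\<Sum>i\<le>n. norm (c i) * norm (c (n - i)))\<^sup>2"
      by (rule power_mono) simp
    also note convolution_square_le
    finally have "(norm (d n))\<^sup>2 * r ^ n \<le> 4 * (\<Sum>i\<le>n. ((norm (c i))\<^sup>2 * sqrt (real i + 1)) *
        ((norm (c (n - i)))\<^sup>2 * sqrt (real (n - i) + 1))) * r ^ n"
      using r by (intro mult_right_mono) auto
    also have "\<dots> = 4 * (\<Sum>i\<le>n. u i * u (n - i))"
    proof -
      have "((norm (c i))\<^sup>2 * sqrt (real i + 1)) * ((norm (c (n - i)))\<^sup>2 * sqrt (real (n - i) + 1)) * r ^ n
          = u i * u (n - i)" if "i \<le> n" for i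
      proof -
        have "r ^ n = r ^ i * r ^ (n - i)" using that by (simp flip: power_add)
        then show ?thesis by (simp add: u_def)
      qed
      then show ?thesis by (simp add: sum_distrib_right mult.assoc)
    qed
    finally show ?thesis .
  qed
  have "(\<lambda>n. \<Sum>i\<le>n. u i * u (n - i)) sums ((\<Sum>k. u k) * (\<Sum>k. u k))"
    by (rule Cauchy_product_sums) (use T u0 in \<open>auto simp: u_def[symmetric] sums_iff\<close>)
  then have "(\<lambda>n. 4 * (\<Sum>i\<le>n. u i * u (n - i))) sums (4 * T\<^sup>2)"
    using T unfolding u_def[symmetric] by (intro sums_mult) (simp add: sums_iff power2_eq_square)
  from sums_le[OF term_le parseval this] show ?thesis .
qed

section \<open>Dyadic estimate of the coefficient majorant\<close>

lemma cauchy_schwarz_power_series: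
  fixes c :: "nat \<Rightarrow> complex"
  assumes "\<And>N. (\<Sum>k<N. (norm (c k))\<^sup>2 * r ^ k) \<le> Q" "0 \<le> r" "r < 1"
  shows "(\<Sum>k<N. norm (c k) * r ^ k) \<le> sqrt (Q / (1 - r))"
proof -
  have "(\<Sum>k<N. norm (c k) * r ^ k)\<^sup>2 = (\<Sum>k<N. (norm (c k) * sqrt (r ^ k)) * sqrt (r ^ k))\<^sup>2"
    using assms by (simp add: mult.assoc)
  also have "\<dots> \<le> (\<Sum>k<N. (norm (c k) * sqrt (r ^ k))\<^sup>2) * (\<Sum>k<N. (sqrt (r ^ k))\<^sup>2)"
    by (rule Cauchy_Schwarz_ineq_sum)
  also have "\<dots> = (\<Sum>k<N. (norm (c k))\<^sup>2 * r ^ k) * (\<Sum>k<N. r ^ k)"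
    using assms by (simp add: power_mult_distrib)
  also have "\<dots> \<le> Q * (1 / (1 - r))"
  proof (rule mult_mono)
    show "(\<Sum>k<N. r ^ k) \<le> 1 / (1 - r)"
      using assms by (subst suminf_geometric[symmetric]) (auto intro!: sum_le_suminf summable_geometric)
    show "0 \<le> Q" using assms(1)[of 0] by simp
  qed (use assms in \<open>auto intro!: sum_nonneg\<close>)
  finally show ?thesis by (simp add: real_le_rsqrt)
qed

lemma hardy2_pointwise:
  fixes c :: "nat \<Rightarrow> complex"
  assumes G: "(\<lambda>k. c k * z ^ k) sums w" and M: "\<And>N. (\<Sum>k<N. (norm (c k))\<^sup>2) \<le> M"
    and z: "(norm z)\<^sup>2 = r" "r < 1"
  shows "(norm w)\<^sup>2 \<le> M / (1 - r)"
proof -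
  have r0: "0 \<le> r" using z(1) by (metis zero_le_power2)
  have "(norm (\<Sum>k<N. c k * z ^ k))\<^sup>2 \<le> M / (1 - r)" for N
  proof -
    have "norm (\<Sum>k<N. c k * z ^ k) \<le> (\<Sum>k<N. norm (c k) * norm z ^ k)"
      by (rule sum_norm_le) (simp add: norm_mult norm_power)
    then have "(norm (\<Sum>k<N. c k * z ^ k))\<^sup>2 \<le> (\<Sum>k<N. norm (c k) * norm z ^ k)\<^sup>2"
      by (rule power_mono) simp
    also have "\<dots> \<le> (\<Sum>k<N. (norm (c k))\<^sup>2) * (\<Sum>k<N. (norm z ^ k)\<^sup>2)"
      by (rule Cauchy_Schwarz_ineq_sum)
    also have "(\<Sum>k<N. (norm z ^ k)\<^sup>2) = (\<Sum>k<N. r ^ k)"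
      by (simp add: z(1)[symmetric] power_mult[symmetric] mult.commute)
    also have "(\<Sum>k<N. (norm (c k))\<^sup>2) * (\<Sum>k<N. r ^ k) \<le> M * (1 / (1 - r))"
    proof (rule mult_mono)
      show "(\<Sum>k<N. r ^ k) \<le> 1 / (1 - r)"
        using r0 z by (subst suminf_geometric[symmetric]) (auto intro!: sum_le_suminf summable_geometric)
      show "0 \<le> M" using M[of 0] by simp
    qed (use M r0 in \<open>auto intro!: sum_nonneg\<close>)
    finally show ?thesis by simp
  qed
  moreover have "(\<lambda>N. (norm (\<Sum>k<N. c k * z ^ k))\<^sup>2) \<longlonglongrightarrow> (norm w)\<^sup>2"
    using G unfolding sums_def by (intro tendsto_intros)
  ultimately show ?thesis by (meson Lim_bounded)
qed

text \<open>With \<open>y = (i + 1) / 2 ^ j\<close> the summand is at most \<open>2 sqrt y / (1 + y)\<close>, which decays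
geometrically on either side of \<open>y = 1\<close>; passing from \<open>j\<close> to \<open>j + 1\<close> halves \<open>y\<close>. The two tails are
handled at once by telescoping: the increments of the bounded function \<open>1 / (1 + sqrt y)\<close> dominate the
summands up to the factor 14.\<close>

lemma dyadic_schur_sum_le:
  "(\<Sum>j<J. sqrt (1 / 2 ^ j) * (sqrt (real i + 1) * (1 - 1 / 2 ^ j) ^ i)) \<le> 14"
proof -
  define y where "y = (\<lambda>j::nat. (real i + 1) / 2 ^ j)"
  define \<Phi> where "\<Phi> = (\<lambda>j. 1 / (1 + sqrt (y j)))"
  have y0: "0 < y j" for j by (simp add: y_def)
  have step: "sqrt (1 / 2 ^ j) * (sqrt (real i + 1) * (1 - 1 / 2 ^ j) ^ i) \<le> 14 * (\<Phi> (Suc j) - \<Phi> j)" for j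
  proof -
    define x :: real where "x = 1 / 2 ^ j"
    have x: "0 < x" "x \<le> 1" by (auto simp: x_def)
    have "(1 - x) ^ i * (1 + real i * x) \<le> (1 - x) ^ i * (1 + x) ^ i"
      using x Bernoulli_inequality[of x i] by (intro mult_left_mono) auto
    also have "\<dots> = ((1 - x) * (1 + x)) ^ i" by (simp add: power_mult_distrib)
    also have "\<dots> \<le> 1" using x by (intro power_le_one) (auto simp: algebra_simps power2_eq_square[symmetric] power_le_one)
    finally have b1: "(1 - x) ^ i * (1 + real i * x) \<le> 1" .
    have yx: "y j = (real i + 1) * x" by (simp add: y_def x_def)
    have "(1 - x) ^ i * (1 + y j) \<le> (1 - x) ^ i * (2 * (1 + real i * x))"
      using x mult_nonneg_nonneg[of x "real i"]
      by (intro mult_left_mono) (auto simp: yx algebra_simps intro: add_increasing2)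
    with b1 have b2: "(1 - x) ^ i \<le> 2 / (1 + y j)" using y0[of j] by (simp add: field_simps)
    define t where "t = sqrt (y j)"
    have t: "0 < t" "t\<^sup>2 = y j" using y0[of j] by (auto simp: t_def)
    have ySuc: "sqrt (y (Suc j)) = t / sqrt 2"
      by (simp add: t_def y_def real_sqrt_divide real_sqrt_mult)
    define s where "s = t / sqrt 2"
    have s: "0 < s" "s \<le> t" "s \<le> (5/7) * t"
    proof -
      \<comment> \<open>\<open>5 / 7\<close> is a rational upper bound for \<open>1 / sqrt 2\<close>; hence \<open>t - s \<ge> 2 t / 7\<close>.\<close>
      have "7 / 5 \<le> sqrt (2::real)" by (rule real_le_rsqrt) (simp add: power2_eq_square)
      then show "s \<le> (5/7) * t" unfolding s_def using t by (simp add: field_simps)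
      then show "s \<le> t" using t by simp
      show "0 < s" using t by (simp add: s_def)
    qed
    have "sqrt (1 / 2 ^ j) * (sqrt (real i + 1) * (1 - 1 / 2 ^ j) ^ i) = t * (1 - x) ^ i"
      by (simp add: t_def yx x_def real_sqrt_mult real_sqrt_divide)
    also have "\<dots> \<le> t * (2 / (1 + t\<^sup>2))" using b2 t by (intro mult_left_mono) auto
    also have "\<dots> \<le> 4 * t / (1 + t)\<^sup>2"
    proof -
      have "(1 + t)\<^sup>2 \<le> 2 * (1 + t\<^sup>2)" using zero_le_power2[of "1 - t"] by (simp add: power2_eq_square algebra_simps)
      then have "2 * t * (1 + t)\<^sup>2 \<le> 2 * t * (2 * (1 + t\<^sup>2))" using t by (intro mult_left_mono) auto
      moreover have "0 < 1 + t\<^sup>2" "0 < (1 + t)\<^sup>2" using t(1) by (auto intro: add_pos_nonneg simp del: t(2))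
      ultimately show ?thesis by (simp add: divide_simps mult_ac)
    qed
    also have "\<dots> = 14 * ((2/7) * t / ((1 + t) * (1 + t)))" by (simp add: power2_eq_square)
    also have "\<dots> \<le> 14 * ((t - s) / ((1 + s) * (1 + t)))"
      using s t by (intro mult_left_mono frac_le mult_right_mono) auto
    also have "(t - s) / ((1 + s) * (1 + t)) = \<Phi> (Suc j) - \<Phi> j"
      using s t by (simp add: \<Phi>_def ySuc s_def[symmetric] t_def[symmetric] field_simps)
    finally show ?thesis .
  qed
  have "(\<Sum>j<J. sqrt (1 / 2 ^ j) * (sqrt (real i + 1) * (1 - 1 / 2 ^ j) ^ i))
      \<le> (\<Sum>j<J. 14 * (\<Phi> (Suc j) - \<Phi> j))"
    by (intro sum_mono step)
  also have "\<dots> = 14 * (\<Phi> J - \<Phi> 0)" by (simp only: sum_distrib_left[symmetric] sum_lessThan_telescope)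
  also have "\<dots> \<le> 14"
  proof -
    have "\<Phi> J \<le> 1" "0 \<le> \<Phi> 0" using y0[of J] y0[of 0] by (auto simp: \<Phi>_def intro!: divide_le_eq_1_pos[THEN iffD2] add_pos_nonneg)
    then show ?thesis by simp
  qed
  finally show ?thesis .
qed

text \<open>The heart of the proof. Put \<open>x = 1 / 2 ^ j\<close> and \<open>r = 1 - x\<close>. By Cauchy--Schwarz the majorant
\<open>\<Sum>k. |a k| r ^ k\<close> is at most \<open>sqrt (Q / x)\<close>, where \<open>Q\<close> is the mean of \<open>|f|\<^sup>2\<close> over the circle of radius
\<open>sqrt r\<close>. There \<open>|f|\<^sup>2 \<le> |G| powr (4 / p)\<close>, and since \<open>4 / p \<ge> 4\<close> all but four powers of \<open>|G|\<close> can be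
replaced by the pointwise bound \<open>|G|\<^sup>2 \<le> M / x\<close>. The remaining fourth power has mean at most
\<open>4 T(r)\<^sup>2\<close>. All powers of \<open>x\<close> except \<open>sqrt x\<close> cancel, and what is left is linear in the
\<open>|c i|\<^sup>2\<close>, so it can be summed over \<open>j\<close> for each \<open>i\<close> separately.\<close>

lemma dyadic_majorant_sum_le_closed_disc:
  fixes f :: "complex \<Rightarrow> complex" and a :: "nat \<Rightarrow> complex"
  assumes \<rho>: "1 < \<rho>" and hol: "f holomorphic_on ball 0 \<rho>" and p: "0 < p" "p \<le> 1"
    and a: "\<And>z. z \<in> ball 0 1 \<Longrightarrow> (\<lambda>k. a k * z ^ k) sums f z"
    and M: "0 < M" "circle_mean (\<lambda>z. norm (f z) powr p) 1 \<le> M"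
  shows "(\<Sum>j<J. (1 / 2 ^ j) powr (1 / p) * (\<Sum>k<K. norm (a k) * (1 - 1 / 2 ^ j) ^ k))
    \<le> 28 * M powr (1 / p)"
proof -
  obtain G where G: "G holomorphic_on ball 0 1"
    "\<And>z. z \<in> ball 0 1 \<Longrightarrow> norm (f z) \<le> norm (G z) powr (2 / p)"
    "\<And>r. 0 \<le> r \<Longrightarrow> r < 1 \<Longrightarrow>
       circle_mean (\<lambda>z. (norm (G z))\<^sup>2) r \<le> circle_mean (\<lambda>z. norm (f z) powr p) 1"
    using hardy_root_majorant[OF \<rho> hol p(1)] by blast
  define c where "c = (\<lambda>n. (deriv ^^ n) G 0 / fact n)"
  have c: "(\<lambda>k. c k * z ^ k) sums G z" if "z \<in> ball 0 1" for z
    using holomorphic_power_series[OF G(1) that] by (simp add: c_def)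
  have c_l2: "(\<Sum>k<N. (norm (c k))\<^sup>2) \<le> M" for N
  proof -
    have "((\<lambda>r. \<Sum>k<N. (norm (c k))\<^sup>2 * (r\<^sup>2) ^ k) \<longlongrightarrow> (\<Sum>k<N. (norm (c k))\<^sup>2 * (1\<^sup>2) ^ k)) (at_left 1)"
      by (intro tendsto_intros)
    moreover have "eventually (\<lambda>r. (\<Sum>k<N. (norm (c k))\<^sup>2 * (r\<^sup>2) ^ k) \<le> M) (at_left 1)"
      using eventually_at_left_real[of 0 "1::real", OF zero_less_one]
    proof eventually_elim
      case (elim r)
      have "(\<Sum>k<N. (norm (c k))\<^sup>2 * (r\<^sup>2) ^ k) \<le> circle_mean (\<lambda>z. (norm (G z))\<^sup>2) r"
        using bessel_power_series[OF c, of r] elim by simp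
      also have "\<dots> \<le> M" using G(3)[of r] elim M(2) by simp
      finally show ?case .
    qed
    ultimately have "(\<Sum>k<N. (norm (c k))\<^sup>2 * (1\<^sup>2) ^ k) \<le> M" by (rule tendsto_upperbound) simp
    then show ?thesis by simp
  qed
  have c_le: "(norm (c i))\<^sup>2 \<le> M" for i
    using c_l2[of "Suc i"] sum_nonneg[of "{..<i}" "\<lambda>k. (norm (c k))\<^sup>2"] by simp
  define T where "T = (\<lambda>r. \<Sum>i. (norm (c i))\<^sup>2 * sqrt (real i + 1) * r ^ i)"
  have T: "(\<lambda>i. (norm (c i))\<^sup>2 * sqrt (real i + 1) * r ^ i) sums T r" if r: "0 \<le> r" "r < 1" for r
    unfolding T_def
  proof (rule summable_sums, rule summable_comparison_test)
    show "\<exists>N. \<forall>i\<ge>N. norm ((norm (c i))\<^sup>2 * sqrt (real i + 1) * r ^ i) \<le> M * (real (Suc i) * r ^ i)"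
    proof (intro exI allI impI)
      fix i
      have "sqrt (real i + 1) \<le> real (Suc i)"
        by (rule real_le_lsqrt) (auto simp: power2_eq_square algebra_simps)
      then have "(norm (c i))\<^sup>2 * sqrt (real i + 1) * r ^ i \<le> M * real (Suc i) * r ^ i"
        using c_le r M(1) by (intro mult_right_mono mult_mono) auto
      then show "norm ((norm (c i))\<^sup>2 * sqrt (real i + 1) * r ^ i) \<le> M * (real (Suc i) * r ^ i)"
        using r by (simp add: mult.assoc)
    qed
    show "summable (\<lambda>i. M * (real (Suc i) * r ^ i))"
      using geometric_deriv_sums[of r] r by (intro summable_mult) (auto simp: sums_iff)
  qed
  have level: "(1 / 2 ^ j) powr (1 / p) * (\<Sum>k<K. norm (a k) * (1 - 1 / 2 ^ j) ^ k)
      \<le> 2 * M powr (1 / p - 1) * (sqrt (1 / 2 ^ j) * T (1 - 1 / 2 ^ j))" for j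
  proof -
    define x :: real where "x = 1 / 2 ^ j"
    define r where "r = 1 - x"
    have x: "0 < x" "x \<le> 1" by (auto simp: x_def)
    have r: "0 \<le> r" "r < 1" "1 - r = x" using x by (auto simp: r_def)
    have sr: "0 \<le> sqrt r" "sqrt r < 1" using r by auto
    have sphere_sub: "sphere 0 (sqrt r) \<subseteq> ball (0::complex) 1" using sr by auto
    have T0: "0 \<le> T r"
      unfolding T_def by (rule suminf_nonneg[OF sums_summable[OF T[OF r(1,2)]]]) (use r in auto)
    define Q where "Q = circle_mean (\<lambda>z. (norm (f z))\<^sup>2) (sqrt r)"
    have fcont: "continuous_on (ball 0 1) f"
      using holomorphic_on_imp_continuous_on[OF hol] \<rho> by (auto intro: continuous_on_subset)
    have "Q \<le> circle_mean (\<lambda>z. (M / x) powr (2 / p - 2) * norm (G z) ^ 4) (sqrt r)"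
      unfolding Q_def
    proof (rule circle_mean_mono[OF _ _ sphere_sub sr(1)])
      show "continuous_on (ball 0 1) (\<lambda>z. (norm (f z))\<^sup>2)" by (intro continuous_intros fcont)
      show "continuous_on (ball 0 1) (\<lambda>z. (M / x) powr (2 / p - 2) * norm (G z) ^ 4)"
        by (intro continuous_intros holomorphic_on_imp_continuous_on[OF G(1)])
      fix z :: complex assume z: "norm z = sqrt r"
      then have zb: "z \<in> ball 0 1" using sr by simp
      have "(norm (G z))\<^sup>2 \<le> M / (1 - r)"
        by (rule hardy2_pointwise[OF c[OF zb] c_l2]) (use z r in auto)
      then have Gle: "(norm (G z))\<^sup>2 \<le> M / x" by (simp add: r)
      have "(norm (f z))\<^sup>2 \<le> (norm (G z) powr (2 / p))\<^sup>2" by (intro power_mono G(2) zb) simp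
      also have "\<dots> = ((norm (G z))\<^sup>2) powr (2 / p - 2) * norm (G z) ^ 4"
      proof (cases "G z = 0")
        case False
        then have pos: "0 < norm (G z)" by simp
        have "(norm (G z) powr (2 / p))\<^sup>2 = norm (G z) powr (4 / p)"
          by (simp add: power2_eq_square powr_add [symmetric])
        moreover have "((norm (G z))\<^sup>2) powr (2 / p - 2) = norm (G z) powr (4 / p - 4)"
        proof -
          have "(norm (G z))\<^sup>2 = norm (G z) powr 2" using pos by simp
          moreover have "2 * (2 / p - 2) = 4 / p - 4" by simp
          ultimately show ?thesis by (simp only: powr_powr)
        qed
        moreover have "norm (G z) ^ 4 = norm (G z) powr 4" using pos by simp
        moreover have "norm (G z) powr (4 / p - 4) * norm (G z) powr 4 = norm (G z) powr (4 / p)"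
          using powr_add[of "norm (G z)" "4 / p - 4" 4] by (simp only: diff_add_cancel)
        ultimately show ?thesis by (simp only:)
      qed simp
      also have "\<dots> \<le> (M / x) powr (2 / p - 2) * norm (G z) ^ 4"
        using Gle p by (intro mult_right_mono powr_mono2) (auto simp: field_simps)
      finally show "(norm (f z))\<^sup>2 \<le> (M / x) powr (2 / p - 2) * norm (G z) ^ 4" .
    qed
    also have "\<dots> = (M / x) powr (2 / p - 2) * circle_mean (\<lambda>z. norm (G z) ^ 4) (sqrt r)"
      by (rule circle_mean_cmult)
    also have "\<dots> \<le> (M / x) powr (2 / p - 2) * (4 * (T r)\<^sup>2)"
      by (intro mult_left_mono mean_fourth_power_le[OF c r(1,2) T[OF r(1,2)]]) auto
    finally have Q: "Q \<le> (M / x) powr (2 / p - 2) * (4 * (T r)\<^sup>2)" .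
    have "(\<Sum>k<N. (norm (a k))\<^sup>2 * r ^ k) \<le> Q" for N
      using bessel_power_series[OF a sr, of N] r(1) unfolding Q_def by simp
    then have "(\<Sum>k<K. norm (a k) * r ^ k) \<le> sqrt (Q / (1 - r))"
      by (rule cauchy_schwarz_power_series) (use r in auto)
    also have "\<dots> \<le> sqrt (((M / x) powr (1 / p - 1) * (2 * T r) / sqrt x)\<^sup>2)"
    proof (rule real_sqrt_le_mono)
      have "((M / x) powr (1 / p - 1))\<^sup>2 = (M / x) powr (2 / p - 2)"
        by (simp add: power2_eq_square powr_add [symmetric])
      then have "((M / x) powr (1 / p - 1) * (2 * T r) / sqrt x)\<^sup>2
          = (M / x) powr (2 / p - 2) * (4 * (T r)\<^sup>2) / x"
        using x by (simp add: power_mult_distrib power_divide)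
      then show "Q / (1 - r) \<le> ((M / x) powr (1 / p - 1) * (2 * T r) / sqrt x)\<^sup>2"
        using Q x r(3) by (simp add: divide_right_mono)
    qed
    also have "\<dots> = (M / x) powr (1 / p - 1) * (2 * T r) / sqrt x"
      using T0 x by simp
    finally have "x powr (1 / p) * (\<Sum>k<K. norm (a k) * r ^ k)
        \<le> x powr (1 / p) * ((M / x) powr (1 / p - 1) * (2 * T r) / sqrt x)"
      by (rule mult_left_mono) simp
    also have "(M / x) powr (1 / p - 1) = M powr (1 / p - 1) * (x / x powr (1 / p))"
      using M(1) x by (simp add: powr_divide powr_diff)
    also have "x powr (1 / p) * (M powr (1 / p - 1) * (x / x powr (1 / p)) * (2 * T r) / sqrt x)
        = 2 * M powr (1 / p - 1) * ((x / sqrt x) * T r)"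
    proof -
      have "x powr (1 / p) \<noteq> 0" using x by simp
      then show ?thesis by (simp add: divide_simps)
    qed
    also have "x / sqrt x = sqrt x" using x by (simp add: real_div_sqrt)
    finally show ?thesis by (simp add: x_def r_def)
  qed
  have "(\<lambda>i. \<Sum>j<J. sqrt (1 / 2 ^ j) * ((norm (c i))\<^sup>2 * sqrt (real i + 1) * (1 - 1 / 2 ^ j) ^ i))
      sums (\<Sum>j<J. sqrt (1 / 2 ^ j) * T (1 - 1 / 2 ^ j))"
    by (intro sums_sum sums_mult T) auto
  moreover have "(\<Sum>i<N. \<Sum>j<J. sqrt (1 / 2 ^ j) * ((norm (c i))\<^sup>2 * sqrt (real i + 1) * (1 - 1 / 2 ^ j) ^ i))
      \<le> 14 * M" for N
  proof -
    have "(\<Sum>i<N. \<Sum>j<J. sqrt (1 / 2 ^ j) * ((norm (c i))\<^sup>2 * sqrt (real i + 1) * (1 - 1 / 2 ^ j) ^ i))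
        = (\<Sum>i<N. (norm (c i))\<^sup>2 * (\<Sum>j<J. sqrt (1 / 2 ^ j) * (sqrt (real i + 1) * (1 - 1 / 2 ^ j) ^ i)))"
      by (simp add: sum_distrib_left mult_ac)
    also have "\<dots> \<le> (\<Sum>i<N. (norm (c i))\<^sup>2 * 14)"
      by (intro sum_mono mult_left_mono dyadic_schur_sum_le) auto
    also have "\<dots> = 14 * (\<Sum>i<N. (norm (c i))\<^sup>2)" by (simp add: sum_distrib_left mult.commute)
    also have "\<dots> \<le> 14 * M" using c_l2 by simp
    finally show ?thesis .
  qed
  ultimately have T_sum: "(\<Sum>j<J. sqrt (1 / 2 ^ j) * T (1 - 1 / 2 ^ j)) \<le> 14 * M"
    unfolding sums_def by (meson Lim_bounded)
  have "(\<Sum>j<J. (1 / 2 ^ j) powr (1 / p) * (\<Sum>k<K. norm (a k) * (1 - 1 / 2 ^ j) ^ k))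
      \<le> (\<Sum>j<J. 2 * M powr (1 / p - 1) * (sqrt (1 / 2 ^ j) * T (1 - 1 / 2 ^ j)))"
    by (intro sum_mono level)
  also have "\<dots> = 2 * M powr (1 / p - 1) * (\<Sum>j<J. sqrt (1 / 2 ^ j) * T (1 - 1 / 2 ^ j))"
    by (simp add: sum_distrib_left)
  also have "\<dots> \<le> 2 * M powr (1 / p - 1) * (14 * M)"
    by (intro mult_left_mono T_sum) auto
  also have "\<dots> = 28 * M powr (1 / p)" using M(1) by (simp add: powr_diff)
  finally show ?thesis .
qed

text \<open>The previous bound does not involve the radius of holomorphy, hence it applies to the dilates
\<open>f (R z)\<close>; truncating the sums at \<open>J\<close> and \<open>K\<close> makes the passage \<open>R \<rightarrow> 1\<close> trivial.\<close>

lemma dyadic_majorant_sum_le: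
  fixes f :: "complex \<Rightarrow> complex" and a :: "nat \<Rightarrow> complex"
  assumes hol: "f holomorphic_on ball 0 1" and p: "0 < p" "p \<le> 1"
    and a: "\<And>z. z \<in> ball 0 1 \<Longrightarrow> (\<lambda>k. a k * z ^ k) sums f z"
    and M: "0 < M" "\<And>r. 0 < r \<Longrightarrow> r < 1 \<Longrightarrow> circle_mean (\<lambda>z. norm (f z) powr p) r \<le> M"
  shows "(\<Sum>j<J. (1 / 2 ^ j) powr (1 / p) * (\<Sum>k<K. norm (a k) * (1 - 1 / 2 ^ j) ^ k))
    \<le> 28 * M powr (1 / p)"
proof -
  let ?S = "\<lambda>R. \<Sum>j<J. (1 / 2 ^ j) powr (1 / p) * (\<Sum>k<K. norm (a k) * R ^ k * (1 - 1 / 2 ^ j) ^ k)"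
  have "(?S \<longlongrightarrow> ?S 1) (at_left 1)" by (intro tendsto_intros)
  moreover have "eventually (\<lambda>R. ?S R \<le> 28 * M powr (1 / p)) (at_left 1)"
    using eventually_at_left_real[of 0 "1::real", OF zero_less_one]
  proof eventually_elim
    case (elim R)
    then have R: "0 < R" "R < 1" by auto
    have "(\<Sum>j<J. (1 / 2 ^ j) powr (1 / p) *
          (\<Sum>k<K. norm (a k * of_real R ^ k) * (1 - 1 / 2 ^ j) ^ k)) \<le> 28 * M powr (1 / p)"
    proof (rule dyadic_majorant_sum_le_closed_disc[OF _ _ p _ M(1)])
      show "1 < 1 / R" using R by simp
      show "(\<lambda>z. f (of_real R * z)) holomorphic_on ball 0 (1 / R)"
        by (rule holomorphic_on_compose_gen[OF _ hol, unfolded o_def])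
           (use R in \<open>auto intro!: holomorphic_intros simp: norm_mult field_simps\<close>)
      show "(\<lambda>k. a k * of_real R ^ k * z ^ k) sums f (of_real R * z)" if "z \<in> ball 0 1" for z
      proof -
        have "norm (of_real R * z) < 1"
          using R that mult_strict_mono'[of R 1 "norm z" 1] by (simp add: norm_mult)
        then have "(\<lambda>k. a k * (of_real R * z) ^ k) sums f (of_real R * z)" by (intro a) simp
        then show ?thesis by (simp add: power_mult_distrib mult.assoc)
      qed
      show "circle_mean (\<lambda>z. norm (f (of_real R * z)) powr p) 1 \<le> M"
        using M(2)[OF R] circle_mean_scale[of "\<lambda>z. norm (f z) powr p" R 1] by simp
    qed
    then show ?case using R by (simp add: norm_mult norm_power)
  qed
  ultimately have "?S 1 \<le> 28 * M powr (1 / p)" by (rule tendsto_upperbound) simp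
  then show ?thesis by simp
qed

section \<open>Carleson measures\<close>

lemma borel_measure_01D:
  assumes "borel_measure_01 \<mu>"
  shows "space \<mu> = {0..<1}"
    and "f \<in> borel_measurable borel \<Longrightarrow> f \<in> borel_measurable \<mu>"
    and "{t..<1} \<inter> {0..<1} \<in> sets \<mu>"
proof -
  have sets: "sets \<mu> = sets (restrict_space borel {0..<1})"
    using assms by (simp add: borel_measure_01_def)
  show "space \<mu> = {0..<1}" using sets_eq_imp_space_eq[OF sets] by (simp add: space_restrict_space)
  show "f \<in> borel_measurable \<mu>" if "f \<in> borel_measurable borel"
    using that measurable_restrict_space1 measurable_cong_sets[OF sets refl] by blast
  show "{t..<1} \<inter> {0..<1} \<in> sets \<mu>"
    unfolding sets by (auto simp: sets_restrict_space)
qed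

lemma carleson_measure_finite:
  assumes "borel_measure_01 \<mu>" "carleson_measure s \<mu>"
  shows "finite_measure \<mu>"
proof (rule finite_measureI)
  obtain C where "emeasure \<mu> {0..<1} \<le> ennreal (C * (1 - 0) powr s)"
    using assms(2) unfolding carleson_measure_def by force
  then show "emeasure \<mu> (space \<mu>) \<noteq> \<infinity>"
    using borel_measure_01D(1)[OF assms(1)] by (auto simp: top_unique)
qed

lemma dyadic_level_exists:
  assumes "0 \<le> t" "t < (1::real)"
  obtains j where "1 - 1 / 2 ^ j \<le> t" "t < 1 - 1 / 2 ^ Suc j"
proof -
  define n where "n = (LEAST n. t < 1 - 1 / 2 ^ n)"
  obtain m where "(1 / 2) ^ m < 1 - t"
    using real_arch_pow_inv[of "1 - t" "1 / 2"] assms by auto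
  then have "t < 1 - 1 / 2 ^ m" by (simp add: power_divide)
  then have n: "t < 1 - 1 / 2 ^ n" unfolding n_def by (rule LeastI)
  then obtain j where j: "n = Suc j" using assms(1) by (cases n) auto
  then have "\<not> t < 1 - 1 / 2 ^ j" using not_less_Least[of j "\<lambda>n. t < 1 - 1 / 2 ^ n"] by (simp add: n_def)
  then have "1 - 1 / 2 ^ j \<le> t" by (rule leI)
  then show ?thesis using that n unfolding j by blast
qed

text \<open>An increasing \<open>P\<close> is at most \<open>P (1 - 1 / 2 ^ (j + 1))\<close> on the dyadic interval that starts at
\<open>1 - 1 / 2 ^ j\<close>, whose measure the Carleson condition controls. The shift by one index costs the
factor \<open>2 powr s\<close>.\<close>

lemma carleson_integral_le_dyadic:
  assumes \<mu>: "borel_measure_01 \<mu>"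
    and C: "\<And>t. t \<in> {0..<1} \<Longrightarrow> emeasure \<mu> {t..<1} \<le> ennreal (C * (1 - t) powr s)"
    and P: "\<And>x y. 0 \<le> x \<Longrightarrow> x \<le> y \<Longrightarrow> y < 1 \<Longrightarrow> P x \<le> P y" "\<And>x. 0 \<le> x \<Longrightarrow> x < 1 \<Longrightarrow> 0 \<le> P x"
    and C0: "0 \<le> C"
    and B: "\<And>J. (\<Sum>j<J. (1 / 2 ^ j) powr s * P (1 - 1 / 2 ^ j)) \<le> B"
  shows "(\<integral>\<^sup>+t. ennreal (P t) \<partial>\<mu>) \<le> ennreal (C * 2 powr s * B)"
proof -
  define A where "A = (\<lambda>j::nat. {1 - 1 / 2 ^ j..<1::real})"
  have A: "A j \<in> sets \<mu>" for j
  proof -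
    have "A j \<inter> {0..<1} = A j" unfolding A_def by (auto intro: order_trans[rotated])
    then show ?thesis using borel_measure_01D(3)[OF \<mu>, of "1 - 1 / 2 ^ j"] by (simp add: A_def)
  qed
  define g where "g = (\<lambda>j. (1 / 2 ^ j) powr s * P (1 - 1 / 2 ^ j))"
  have g0: "0 \<le> g j" for j unfolding g_def by (intro mult_nonneg_nonneg P(2)) auto
  have "(\<integral>\<^sup>+t. ennreal (P t) \<partial>\<mu>)
      \<le> (\<integral>\<^sup>+t. (\<Sum>j. ennreal (P (1 - 1 / 2 ^ Suc j)) * indicator (A j) t) \<partial>\<mu>)"
  proof (rule nn_integral_mono)
    fix t assume "t \<in> space \<mu>"
    then have t: "0 \<le> t" "t < 1" using borel_measure_01D(1)[OF \<mu>] by auto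
    obtain j where j: "1 - 1 / 2 ^ j \<le> t" "t < 1 - 1 / 2 ^ Suc j" using dyadic_level_exists[OF t] .
    have "ennreal (P t) \<le> ennreal (P (1 - 1 / 2 ^ Suc j))"
      by (intro ennreal_leI P(1)) (use t j in auto)
    also have "\<dots> = (\<Sum>i\<in>{j}. ennreal (P (1 - 1 / 2 ^ Suc i)) * indicator (A i) t)"
      using j t by (simp add: A_def)
    also have "\<dots> \<le> (\<Sum>i. ennreal (P (1 - 1 / 2 ^ Suc i)) * indicator (A i) t)"
      by (rule sum_le_suminf) auto
    finally show "ennreal (P t) \<le> (\<Sum>j. ennreal (P (1 - 1 / 2 ^ Suc j)) * indicator (A j) t)" .
  qed
  also have "\<dots> = (\<Sum>j. \<integral>\<^sup>+t. ennreal (P (1 - 1 / 2 ^ Suc j)) * indicator (A j) t \<partial>\<mu>)"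
    using A by (intro nn_integral_suminf borel_measurable_times_ennreal borel_measurable_indicator) auto
  also have "\<dots> = (\<Sum>j. ennreal (P (1 - 1 / 2 ^ Suc j)) * emeasure \<mu> (A j))"
    using A by (simp add: nn_integral_cmult_indicator)
  also have "\<dots> \<le> (\<Sum>j. ennreal (C * 2 powr s * g (Suc j)))"
  proof (rule suminf_le)
    fix j
    have "emeasure \<mu> (A j) \<le> ennreal (C * (1 / 2 ^ j) powr s)"
      using C[of "1 - 1 / 2 ^ j"] unfolding A_def by simp
    then have "ennreal (P (1 - 1 / 2 ^ Suc j)) * emeasure \<mu> (A j)
        \<le> ennreal (P (1 - 1 / 2 ^ Suc j)) * ennreal (C * (1 / 2 ^ j) powr s)"
      by (rule mult_left_mono) simp
    also have "\<dots> = ennreal (P (1 - 1 / 2 ^ Suc j) * (C * (1 / 2 ^ j) powr s))"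
      using C0 by (intro ennreal_mult[symmetric] P(2)) (auto simp del: power_Suc)
    also have "(1 / 2 ^ j) powr s = (2 * (1 / 2 ^ Suc j)) powr s" by simp
    also have "\<dots> = 2 powr s * (1 / 2 ^ Suc j) powr s" by (rule powr_mult)
    finally show "ennreal (P (1 - 1 / 2 ^ Suc j)) * emeasure \<mu> (A j) \<le> ennreal (C * 2 powr s * g (Suc j))"
      by (simp add: g_def mult_ac)
  qed auto
  also have "\<dots> \<le> ennreal (C * 2 powr s * B)"
  proof (rule suminf_le_const)
    fix J
    have "(\<Sum>j<J. ennreal (C * 2 powr s * g (Suc j))) = ennreal (\<Sum>j<J. C * 2 powr s * g (Suc j))"
      using g0 C0 by (intro sum_ennreal) auto
    also have "\<dots> \<le> ennreal (C * 2 powr s * B)"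
    proof (rule ennreal_leI)
      have "(\<Sum>j<J. g (Suc j)) \<le> (\<Sum>j<Suc J. g j)"
        using g0[of 0] by (simp only: sum.lessThan_Suc_shift)
      also have "\<dots> \<le> B" unfolding g_def by (rule B)
      finally show "(\<Sum>j<J. C * 2 powr s * g (Suc j)) \<le> C * 2 powr s * B"
        using C0 by (simp add: sum_distrib_left[symmetric] mult_left_mono)
    qed
    finally show "(\<Sum>j<J. ennreal (C * 2 powr s * g (Suc j))) \<le> ennreal (C * 2 powr s * B)" .
  qed auto
  finally show ?thesis .
qed

section \<open>Moments and Hardy space coefficients\<close>

lemma power_integrable_01:
  assumes "borel_measure_01 \<mu>" "finite_measure \<mu>"
  shows "integrable \<mu> (\<lambda>t. t ^ n)"
proof (rule finite_measure.integrable_const_bound[OF assms(2), where B = 1])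
  show "AE t in \<mu>. norm (t ^ n) \<le> 1"
    by (rule AE_I2) (use borel_measure_01D(1)[OF assms(1)] in \<open>auto intro: power_le_one\<close>)
  show "(\<lambda>t. t ^ n) \<in> borel_measurable \<mu>" by (rule borel_measure_01D(2)[OF assms(1)]) measurable
qed

lemma coefficient_moments_summable:
  assumes \<mu>: "borel_measure_01 \<mu>" "carleson_measure (1 / p) \<mu>" and p: "0 < p" "p \<le> 1"
    and hol: "f holomorphic_on ball 0 1"
    and a: "\<And>z. z \<in> ball 0 1 \<Longrightarrow> (\<lambda>k. a k * z ^ k) sums f z"
    and M: "\<And>r. 0 < r \<Longrightarrow> r < 1 \<Longrightarrow> circle_mean (\<lambda>z. norm (f z) powr p) r \<le> M"
  shows "summable (\<lambda>k. norm (a k) * (\<integral>t. t ^ k \<partial>\<mu>))"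
proof -
  obtain C where C: "0 < C" "\<And>t. t \<in> {0..<1} \<Longrightarrow> emeasure \<mu> {t..<1} \<le> ennreal (C * (1 - t) powr (1 / p))"
    using \<mu>(2) unfolding carleson_measure_def by blast
  \<comment> \<open>A strictly positive bound is needed to manipulate real powers of it.\<close>
  define M' where "M' = max M 1"
  define B where "B = C * 2 powr (1 / p) * (28 * M' powr (1 / p))"
  note fin = carleson_measure_finite[OF \<mu>]
  have int: "integrable \<mu> (\<lambda>t. t ^ k)" for k by (rule power_integrable_01[OF \<mu>(1) fin])
  have mom0: "0 \<le> (\<integral>t. t ^ k \<partial>\<mu>)" for k
    by (rule integral_nonneg_AE, rule AE_I2) (use borel_measure_01D(1)[OF \<mu>(1)] in auto)
  have B0: "0 \<le> B" using C(1) by (simp add: B_def)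
  have "(\<Sum>k<K. norm (a k) * (\<integral>t. t ^ k \<partial>\<mu>)) \<le> B" for K
  proof -
    let ?P = "\<lambda>t. \<Sum>k<K. norm (a k) * t ^ k"
    have "(\<integral>\<^sup>+t. ennreal (?P t) \<partial>\<mu>) \<le> ennreal B"
      unfolding B_def
    proof (rule carleson_integral_le_dyadic[OF \<mu>(1) C(2)])
      show "(\<Sum>j<J. (1 / 2 ^ j) powr (1 / p) * ?P (1 - 1 / 2 ^ j)) \<le> 28 * M' powr (1 / p)" for J
        by (rule dyadic_majorant_sum_le[OF hol p a]) (use M in \<open>auto simp: M'_def intro: le_max_iff_disj[THEN iffD2]\<close>)
    qed (use C(1) in \<open>auto intro!: sum_mono mult_left_mono power_mono sum_nonneg\<close>)
    moreover have "(\<integral>\<^sup>+t. ennreal (?P t) \<partial>\<mu>) = ennreal (\<integral>t. ?P t \<partial>\<mu>)"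
      using borel_measure_01D(1)[OF \<mu>(1)]
      by (intro nn_integral_eq_integral Bochner_Integration.integrable_sum integrable_mult_right int AE_I2)
         (auto intro!: sum_nonneg)
    ultimately have "(\<integral>t. ?P t \<partial>\<mu>) \<le> B" using B0 by (simp add: ennreal_le_iff)
    then show ?thesis using int by simp
  qed
  then have "(\<Sum>k\<le>n. norm (a k) * (\<integral>t. t ^ k \<partial>\<mu>)) \<le> B" for n
    unfolding lessThan_Suc_atMost[symmetric] .
  with mom0 show ?thesis by (intro bounded_imp_summable[where B = B]) auto
qed

lemma hardy_space_circle_mean_bounded:
  assumes "0 < p" "f \<in> hardy_space p"
  obtains M where "\<And>r. 0 < r \<Longrightarrow> r < 1 \<Longrightarrow> circle_mean (\<lambda>z. norm (f z) powr p) r \<le> M"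
proof -
  have "hardy_norm p f < \<infinity>" using assms(2) by (simp add: hardy_space_def)
  then obtain B where B: "hardy_norm p f = ennreal B" "0 \<le> B"
    by (cases "hardy_norm p f") auto
  show ?thesis
  proof (rule that[of "B powr p"])
    fix r :: real assume r: "0 < r" "r < 1"
    let ?m = "circle_mean (\<lambda>z. norm (f z) powr p) r"
    have m: "hardy_mean p f r = ?m powr (1 / p)" by (simp add: hardy_mean_def circle_mean_def)
    have "ennreal (hardy_mean p f r) \<le> hardy_norm p f"
      unfolding hardy_norm_def by (rule SUP_upper) (use r in auto)
    then have "?m powr (1 / p) \<le> B" using B by (simp add: m)
    then have "(?m powr (1 / p)) powr p \<le> B powr p" using assms(1) by (intro powr_mono2) auto
    moreover have "0 \<le> ?m" by (rule circle_mean_nonneg) (use r in auto)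
    ultimately show "?m \<le> B powr p" using assms(1) by (simp add: powr_powr)
  qed
qed

text \<open>The inclusion of \<open>H\<^sup>p\<close> in \<open>H\<^sup>1\<close> for \<open>p \<ge> 1\<close>. The crude bound \<open>x \<le> 1 + x powr p\<close> replaces
Hoelder's inequality, since finiteness is all that matters.\<close>

lemma circle_mean_norm_le:
  assumes "f holomorphic_on ball 0 1" "1 \<le> p" "0 < r" "r < 1"
  shows "circle_mean (\<lambda>z. norm (f z) powr 1) r \<le> 1 + circle_mean (\<lambda>z. norm (f z) powr p) r"
proof -
  have cont: "continuous_on (ball 0 1) (\<lambda>z. norm (f z) powr q)" if "0 < q" for q
    by (intro continuous_on_powr' continuous_intros holomorphic_on_imp_continuous_on[OF assms(1)])
       (use that in auto)
  have sub: "sphere 0 r \<subseteq> ball (0::complex) 1" using assms by auto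
  have "circle_mean (\<lambda>z. norm (f z) powr 1) r \<le> circle_mean (\<lambda>z. 1 + norm (f z) powr p) r"
  proof (rule circle_mean_mono[OF _ _ sub])
    fix z
    show "norm (f z) powr 1 \<le> 1 + norm (f z) powr p"
    proof (cases "norm (f z) \<le> 1")
      case True
      then show ?thesis by (simp add: add_increasing2)
    next
      case False
      then have "norm (f z) powr 1 \<le> norm (f z) powr p" using assms(2) by (intro powr_mono) auto
      then show ?thesis by linarith
    qed
  qed (use assms cont[of 1] cont[of p] in \<open>auto intro!: continuous_on_add continuous_on_const\<close>)
  also have "\<dots> = circle_mean (\<lambda>z. 1) r + circle_mean (\<lambda>z. norm (f z) powr p) r"
    by (rule circle_mean_add[OF _ _ sub]) (use assms in \<open>auto intro!: cont\<close>)
  finally show ?thesis by simp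
qed

text \<open>For a 1-Carleson measure and \<open>p = 1\<close> this is the essence of Hardy's inequality
\<open>\<Sum>k. |a k| / (k + 1) < \<infinity>\<close>. It is the only point where the Hardy space enters the theorem.\<close>

lemma hardy_coefficient_moments_summable:
  assumes p: "0 < p" and \<mu>: "borel_measure_01 \<mu>"
    and carleson: "(0 < p \<and> p \<le> 1 \<and> carleson_measure (1 / p) \<mu>) \<or> (1 < p \<and> carleson_measure 1 \<mu>)"
    and f: "f \<in> hardy_space p"
    and a: "\<And>z. z \<in> ball 0 1 \<Longrightarrow> (\<lambda>k. a k * z ^ k) sums f z"
  shows "finite_measure \<mu>" "summable (\<lambda>k. norm (a k) * (\<integral>t. t ^ k \<partial>\<mu>))"
proof -
  show "finite_measure \<mu>" using carleson carleson_measure_finite[OF \<mu>] by blast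
  have hol: "f holomorphic_on ball 0 1" using f by (simp add: hardy_space_def)
  obtain M where M: "\<And>r. 0 < r \<Longrightarrow> r < 1 \<Longrightarrow> circle_mean (\<lambda>z. norm (f z) powr p) r \<le> M"
    using hardy_space_circle_mean_bounded[OF p f] by blast
  show "summable (\<lambda>k. norm (a k) * (\<integral>t. t ^ k \<partial>\<mu>))"
    using carleson
  proof
    assume "0 < p \<and> p \<le> 1 \<and> carleson_measure (1 / p) \<mu>"
    then show ?thesis using coefficient_moments_summable[OF \<mu> _ _ _ hol a M] by blast
  next
    assume p1: "1 < p \<and> carleson_measure 1 \<mu>"
    have "circle_mean (\<lambda>z. norm (f z) powr 1) r \<le> 1 + M" if "0 < r" "r < 1" for r
      using circle_mean_norm_le[OF hol _ that, of p] M[OF that] p1 by simp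
    then show ?thesis using coefficient_moments_summable[OF \<mu> _ _ _ hol a, of 1 "1 + M"] p1 by simp
  qed
qed

section \<open>The generalized Hankel operator\<close>

lemma gamma_binomial_coefficient:
  assumes "0 < \<alpha>"
  shows "Gamma (real n + \<alpha>) / (fact n * Gamma \<alpha>) = pochhammer \<alpha> n / fact n"
proof -
  have "\<alpha> \<notin> \<int>\<^sub>\<le>\<^sub>0" using assms nonpos_Ints_nonpos by force
  then show ?thesis using pochhammer_Gamma[of \<alpha> n] by (simp add: add.commute)
qed

lemma negative_binomial_series:
  fixes w :: complex
  assumes "norm w < 1"
  shows "(\<lambda>n. of_real (pochhammer \<alpha> n / fact n) * w ^ n) sums (1 - w) powr (- of_real \<alpha>)"
proof -
  have "(\<lambda>n. (- of_real \<alpha> gchoose n) * (- w) ^ n) sums (1 + - w) powr (- of_real \<alpha>)"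
    by (rule gen_binomial_complex) (use assms in simp)
  moreover have "(- of_real \<alpha> gchoose n) * (- w) ^ n = of_real (pochhammer \<alpha> n / fact n) * w ^ n" for n
  proof -
    have "(- of_real \<alpha> gchoose n) * (- w) ^ n
        = ((- 1) ^ n * pochhammer (of_real \<alpha>) n / fact n) * ((- 1) ^ n * w ^ n)"
      by (simp add: gbinomial_pochhammer power_minus[of w])
    also have "\<dots> = ((- 1) ^ n * (- 1) ^ n) * (pochhammer (of_real \<alpha>) n / fact n * w ^ n)"
      by simp
    also have "((- 1) ^ n * (- 1) ^ n :: complex) = 1" by (simp flip: power_mult_distrib)
    finally show ?thesis by (simp add: pochhammer_of_real)
  qed
  ultimately show ?thesis by simp
qed

text \<open>Both interchanges of sum and integral are dominated: the inner one because the moments decrease,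
so that \<open>\<Sum>k. |a k| m (n + k)\<close> converges for every \<open>n\<close>, and the outer one by the integrable
function \<open>|f(t)|\<close> times the convergent series \<open>\<Sum>n. \<gamma> n |z| ^ n\<close>.\<close>

theorem theorem2p1:
  fixes p \<alpha> :: real and \<mu> :: "real measure"
    and f :: "complex \<Rightarrow> complex" and a :: "nat \<Rightarrow> complex"
  assumes "0 < p" and "0 < \<alpha>"
    and "borel_measure_01 \<mu>"
    and "(0 < p \<and> p \<le> 1 \<and> carleson_measure (1 / p) \<mu>) \<or> (1 < p \<and> carleson_measure 1 \<mu>)"
    and "f \<in> hardy_space p"
    and "\<And>z. z \<in> ball 0 1 \<Longrightarrow> (\<lambda>k. a k * z ^ k) sums f z"
  shows "(\<forall>n k. integrable \<mu> (\<lambda>t. Gamma (real n + \<alpha>) / (fact n * Gamma \<alpha>) * t ^ (n + k)))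
    \<and> (\<forall>n. summable (\<lambda>k. of_real (hankel_entry \<mu> \<alpha> n k) * a k))
    \<and> (\<forall>z\<in>ball 0 1. summable (\<lambda>n. hankel_coeff \<mu> \<alpha> a n * z ^ n))
    \<and> hankel_op \<mu> \<alpha> a holomorphic_on ball 0 1
    \<and> (\<forall>z\<in>ball 0 1.
         integrable \<mu> (\<lambda>t. f (of_real t) / (1 - of_real t * z) powr of_real \<alpha>)
       \<and> hankel_op \<mu> \<alpha> a z = (\<integral>t. f (of_real t) / (1 - of_real t * z) powr of_real \<alpha> \<partial>\<mu>))"
proof -
  note \<mu> = assms(3) and a = assms(6)
  note space = borel_measure_01D(1)[OF \<mu>]
  define m where "m = (\<lambda>k. \<integral>t. t ^ k \<partial>\<mu>)"
  have fin: "finite_measure \<mu>" and m_sum: "summable (\<lambda>k. norm (a k) * m k)"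
    using hardy_coefficient_moments_summable[OF assms(1,3,4,5) a] unfolding m_def by blast+
  define \<gamma> where "\<gamma> = (\<lambda>n. pochhammer \<alpha> n / fact n)"
  have \<gamma>: "Gamma (real n + \<alpha>) / (fact n * Gamma \<alpha>) = \<gamma> n" for n
    unfolding \<gamma>_def by (rule gamma_binomial_coefficient[OF assms(2)])
  have \<gamma>0: "0 \<le> \<gamma> n" for n using assms(2) by (simp add: \<gamma>_def pochhammer_nonneg)
  have int_pow: "integrable \<mu> (\<lambda>t. t ^ k)" for k by (rule power_integrable_01[OF \<mu> fin])
  have int_cpow: "integrable \<mu> (\<lambda>t. (of_real t :: complex) ^ k)" for k
    using integrable_of_real[OF int_pow[of k], where 'a = complex] by simp
  have entry: "hankel_entry \<mu> \<alpha> n k = \<gamma> n * m (n + k)" for n k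
    unfolding hankel_entry_def \<gamma> m_def by simp
  have m0: "0 \<le> m k" for k
    unfolding m_def by (rule integral_nonneg_AE, rule AE_I2) (use space in auto)
  have m_le: "m (n + k) \<le> m k" for n k
    unfolding m_def
    by (rule integral_mono[OF int_pow int_pow]) (use space in \<open>auto intro: power_decreasing\<close>)
  have series: "(\<lambda>k. a k * of_real t ^ k) sums f (of_real t)" if "t \<in> space \<mu>" for t
    using a[of "of_real t"] that space by simp
  define I where "I = (\<lambda>n. \<integral>t. of_real t ^ n * f (of_real t) \<partial>\<mu>)"
  have inner: "integrable \<mu> (\<lambda>t. of_real t ^ n * f (of_real t))
      \<and> (\<lambda>k. of_real (m (n + k)) * a k) sums I n" for n
  proof -
    let ?g = "\<lambda>k t. of_real t ^ (n + k) * a k"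
    have gi: "integrable \<mu> (?g k)" for k by (intro integrable_mult_left int_cpow)
    have gs: "(\<lambda>k. ?g k t) sums (of_real t ^ n * f (of_real t))" if "t \<in> space \<mu>" for t
      using sums_mult[OF series[OF that], of "of_real t ^ n"] by (simp add: power_add mult_ac)
    have ae: "AE t in \<mu>. summable (\<lambda>k. norm (?g k t))"
    proof (rule AE_I2)
      fix t assume "t \<in> space \<mu>"
      then have t: "0 \<le> t" "t < 1" using space by auto
      have "summable (\<lambda>k. norm (a k) * t ^ k)"
        by (rule power_series_abs_summable) (use a t in \<open>auto simp: sums_iff\<close>)
      from summable_mult[OF this, of "t ^ n"] show "summable (\<lambda>k. norm (?g k t))"
        using t by (simp add: norm_mult norm_power power_add mult_ac)
    qed
    have norm_int: "(\<integral>t. norm (?g k t) \<partial>\<mu>) = norm (a k) * m (n + k)" for k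
    proof -
      have "(\<integral>t. norm (?g k t) \<partial>\<mu>) = (\<integral>t. t ^ (n + k) * norm (a k) \<partial>\<mu>)"
        by (rule Bochner_Integration.integral_cong) (use space in \<open>auto simp: norm_mult norm_power\<close>)
      then show ?thesis by (simp add: m_def)
    qed
    have sm: "summable (\<lambda>k. \<integral>t. norm (?g k t) \<partial>\<mu>)"
      unfolding norm_int
      by (rule summable_comparison_test'[OF m_sum, of 0]) (use m0 m_le in \<open>auto intro: mult_left_mono\<close>)
    have eq: "(\<Sum>k. ?g k t) = of_real t ^ n * f (of_real t)" if "t \<in> space \<mu>" for t
      using gs[OF that] by (simp add: sums_iff)
    have "integrable \<mu> (\<lambda>t. \<Sum>k. ?g k t)" by (rule integrable_suminf[OF gi ae sm])
    then have int_n: "integrable \<mu> (\<lambda>t. of_real t ^ n * f (of_real t))"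
      by (rule Bochner_Integration.integrable_cong[THEN iffD1, rotated 2]) (auto simp: eq)
    have int_sums: "(\<lambda>k. \<integral>t. ?g k t \<partial>\<mu>) sums (\<integral>t. (\<Sum>k. ?g k t) \<partial>\<mu>)"
      by (rule sums_integral[OF gi ae sm])
    have int_sum: "(\<integral>t. (\<Sum>k. ?g k t) \<partial>\<mu>) = I n"
      unfolding I_def by (rule Bochner_Integration.integral_cong) (auto simp: eq)
    have int_term: "(\<integral>t. ?g k t \<partial>\<mu>) = of_real (m (n + k)) * a k" for k
    proof -
      have "(\<integral>t. ?g k t \<partial>\<mu>) = (\<integral>t. of_real (t ^ (n + k)) \<partial>\<mu>) * a k"
        by simp
      then show ?thesis by (simp only: integral_complex_of_real m_def)
    qed
    have "(\<lambda>k. of_real (m (n + k)) * a k) sums I n"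
      using int_sums by (simp only: int_sum int_term)
    with int_n show ?thesis ..
  qed
  have int_f: "integrable \<mu> (\<lambda>t. of_real t ^ n * f (of_real t))" for n using inner by blast
  have entries: "(\<lambda>k. of_real (hankel_entry \<mu> \<alpha> n k) * a k) sums (of_real (\<gamma> n) * I n)" for n
    using sums_mult[OF conjunct2[OF inner[of n]], of "of_real (\<gamma> n)"] by (simp add: entry mult.assoc)
  then have coeff: "hankel_coeff \<mu> \<alpha> a n = of_real (\<gamma> n) * I n" for n
    unfolding hankel_coeff_def by (simp add: sums_iff)
  have outer: "integrable \<mu> (\<lambda>t. f (of_real t) / (1 - of_real t * z) powr of_real \<alpha>)
      \<and> (\<lambda>n. hankel_coeff \<mu> \<alpha> a n * z ^ n) sums
        (\<integral>t. f (of_real t) / (1 - of_real t * z) powr of_real \<alpha> \<partial>\<mu>)"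
    if z: "z \<in> ball 0 1" for z
  proof -
    let ?g = "\<lambda>n t. of_real (\<gamma> n) * z ^ n * (of_real t ^ n * f (of_real t))"
    let ?F = "\<lambda>t. f (of_real t) / (1 - of_real t * z) powr of_real \<alpha>"
    have gi: "integrable \<mu> (?g n)" for n by (intro integrable_mult_right int_f)
    have \<gamma>_sum: "summable (\<lambda>n. \<gamma> n * r ^ n)" if "0 \<le> r" "r < 1" for r
    proof -
      have "summable (\<lambda>n. norm (complex_of_real (\<gamma> n)) * r ^ n)"
        by (rule power_series_abs_summable)
           (use negative_binomial_series that in \<open>auto simp: \<gamma>_def sums_iff\<close>)
      then show ?thesis using \<gamma>0 by simp
    qed
    have tz: "norm (of_real t * z) < 1" if "t \<in> space \<mu>" for t
      using that space z mult_strict_mono'[of t 1 "norm z" 1] by (simp add: norm_mult)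
    have eq: "(\<Sum>n. ?g n t) = ?F t" if t: "t \<in> space \<mu>" for t
    proof -
      have "(\<lambda>n. f (of_real t) * (of_real (\<gamma> n) * (of_real t * z) ^ n)) sums
          (f (of_real t) * (1 - of_real t * z) powr (- of_real \<alpha>))"
        unfolding \<gamma>_def by (intro sums_mult negative_binomial_series tz t)
      then show ?thesis
        by (simp add: sums_iff power_mult_distrib powr_minus divide_inverse mult_ac)
    qed
    have ae: "AE t in \<mu>. summable (\<lambda>n. norm (?g n t))"
    proof (rule AE_I2)
      fix t assume t: "t \<in> space \<mu>"
      have "summable (\<lambda>n. norm (f (of_real t)) * (\<gamma> n * norm (of_real t * z) ^ n))"
        by (intro summable_mult \<gamma>_sum tz t) simp
      then show "summable (\<lambda>n. norm (?g n t))"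
        using \<gamma>0 by (simp add: norm_mult norm_power power_mult_distrib mult_ac)
    qed
    have int_abs: "integrable \<mu> (\<lambda>t. norm (f (of_real t)))"
      using integrable_norm[OF int_f[of 0]] by simp
    have sm: "summable (\<lambda>n. \<integral>t. norm (?g n t) \<partial>\<mu>)"
    proof (rule summable_comparison_test'[where N = 0])
      show "summable (\<lambda>n. (\<gamma> n * norm z ^ n) * (\<integral>t. norm (f (of_real t)) \<partial>\<mu>))"
        by (intro summable_mult2 \<gamma>_sum) (use z in auto)
      fix n
      have "(\<integral>t. norm (?g n t) \<partial>\<mu>) \<le> (\<integral>t. (\<gamma> n * norm z ^ n) * norm (f (of_real t)) \<partial>\<mu>)"
      proof (rule integral_mono)
        fix t assume "t \<in> space \<mu>"
        then have t: "0 \<le> t" "t < 1" using space by auto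
        have "t ^ n * norm (f (of_real t)) \<le> 1 * norm (f (of_real t))"
          using t by (intro mult_right_mono power_le_one) auto
        then have "(\<gamma> n * norm z ^ n) * (t ^ n * norm (f (of_real t)))
            \<le> (\<gamma> n * norm z ^ n) * norm (f (of_real t))"
          using \<gamma>0[of n] by (intro mult_left_mono) auto
        then show "norm (?g n t) \<le> (\<gamma> n * norm z ^ n) * norm (f (of_real t))"
          using \<gamma>0 t by (simp add: norm_mult norm_power)
      qed (intro integrable_norm gi, intro integrable_mult_right int_abs)
      then show "norm (\<integral>t. norm (?g n t) \<partial>\<mu>) \<le> (\<gamma> n * norm z ^ n) * (\<integral>t. norm (f (of_real t)) \<partial>\<mu>)"
        by simp
    qed
    have "integrable \<mu> (\<lambda>t. \<Sum>n. ?g n t)" by (rule integrable_suminf[OF gi ae sm])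
    then have "integrable \<mu> ?F"
      by (rule Bochner_Integration.integrable_cong[THEN iffD1, rotated 2]) (auto simp: eq)
    have int_sums: "(\<lambda>n. \<integral>t. ?g n t \<partial>\<mu>) sums (\<integral>t. (\<Sum>n. ?g n t) \<partial>\<mu>)"
      by (rule sums_integral[OF gi ae sm])
    have int_sum: "(\<integral>t. (\<Sum>n. ?g n t) \<partial>\<mu>) = (\<integral>t. ?F t \<partial>\<mu>)"
      by (rule Bochner_Integration.integral_cong) (auto simp: eq)
    have int_term: "(\<integral>t. ?g n t \<partial>\<mu>) = hankel_coeff \<mu> \<alpha> a n * z ^ n" for n
    proof -
      have "(\<integral>t. ?g n t \<partial>\<mu>) = of_real (\<gamma> n) * z ^ n * I n"
        unfolding I_def by (rule integral_mult_right_zero)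
      then show ?thesis by (simp add: coeff mult_ac)
    qed
    have "(\<lambda>n. hankel_coeff \<mu> \<alpha> a n * z ^ n) sums (\<integral>t. ?F t \<partial>\<mu>)"
      using int_sums by (simp only: int_sum int_term)
    with \<open>integrable \<mu> ?F\<close> show ?thesis ..
  qed
  have op: "(\<lambda>n. hankel_coeff \<mu> \<alpha> a n * z ^ n) sums hankel_op \<mu> \<alpha> a z" if "z \<in> ball 0 1" for z
    using outer[OF that] unfolding hankel_op_def by (simp add: sums_iff)
  have "hankel_op \<mu> \<alpha> a holomorphic_on ball 0 1"
    by (rule power_series_holomorphic[where a = "hankel_coeff \<mu> \<alpha> a"]) (use op in simp)
  moreover have "integrable \<mu> (\<lambda>t. Gamma (real n + \<alpha>) / (fact n * Gamma \<alpha>) * t ^ (n + k))" for n k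
    by (intro integrable_mult_right int_pow)
  moreover have "hankel_op \<mu> \<alpha> a z = (\<integral>t. f (of_real t) / (1 - of_real t * z) powr of_real \<alpha> \<partial>\<mu>)"
    if "z \<in> ball 0 1" for z
    using op[OF that] outer[OF that] sums_unique2 by blast
  ultimately show ?thesis
    using sums_summable[OF entries] sums_summable[OF op] outer by blast
qed

end
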